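(* Let $G$ be a (multiplicative) abelian group and let $k,\ell\ge1$ be integers. For every $\vec r\in\mathbb Z_{\ge1}^k$, $\vec w=(w_1,\dots,w_k)\in G^k$, $\vec s\in\mathbb Z_{\ge1}^\ell$, $\vec z=(z_1,\dots,z_\ell)\in G^\ell$, the following identity holds in $(\mathcal H(\mathbb Z_{\ge1}\times G),\sqcup\!\sqcup_\eta)$: $$\binom{\vec r}{\vec w}\sqcup\!\sqcup_\eta\binom{\vec s}{\vec z}=\sum_{(\varphi,\psi)\in I_{k,\ell}}\ \sum_{\substack{\vec t\in\mathbb Z_{\ge1}^{k+\ell}\\ |\vec t|=|\vec r|+|\vec s|}} c_{\vec r,\vec s}^{\vec t,(\varphi,\psi)}\binom{\vec t}{\vec w\,\overline{\sqcup\!\sqcup}_{(\varphi,\psi)}\vec z}.$$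
   Context: Words and the algebra: an element of the free monoid on $\mathbb Z_{\ge1}\times G$ is written $\binom{s_1,\dots,s_k}{b_1,\dots,b_k}$ (the word $(s_1,b_1)\cdots(s_k,b_k)$); the empty word is $1$; $\mathcal H(\mathbb Z_{\ge1}\times G)$ is the free abelian group on these words. Let $x_0$ and $x_b$ ($b\in G$) be pairwise distinct letters (indexed by the disjoint union $\{0\}\sqcup G$) and $\sqcup\!\sqcup$ the shuffle product on the free abelian group of words in them: $1\sqcup\!\sqcup w=w\sqcup\!\sqcup1=w$, $(a_1u)\sqcup\!\sqcup(b_1v)=a_1(u\sqcup\!\sqcup b_1v)+b_1(a_1u\sqcup\!\sqcup v)$. The span $\mathcal H_1$ of $1$ and words ending in some $x_b$ ($b\in G$) is closed under $\sqcup\!\sqcup$ and has basis $1$ and $x_0^{s_1-1}x_{b_1}\cdots x_0^{s_k-1}x_{b_k}$. Let $\eta:\mathcal H_1\to\mathcal H(\mathbb Z_{\ge1}\times G)$ be the linear bijection $x_0^{s_1-1}x_{b_1}\cdots x_0^{s_k-1}x_{b_k}\mapsto\binom{s_1,\,s_2,\dots,\,s_k}{1/b_1,\,b_1/b_2,\dots,\,b_{k-1}/b_k}$, $1\mapsto1$, and $u\sqcup\!\sqcup_\eta v=\eta(\eta^{-1}(u)\sqcup\!\sqcup\eta^{-1}(v))$. Coefficients: $[k]=\{1,\dots,k\}$; $I_{k,\ell}$ is the set of pairs $(\varphi,\psi)$ of order-preserving injective maps $\varphi:[k]\to[k+\ell]$, $\psi:[\ell]\to[k+\ell]$ with $\mathrm{im}\,\varphi\sqcup\mathrm{im}\,\psi=[k+\ell]$;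 $|\vec x|$ is the sum of entries. For $\vec t\in\mathbb Z_{\ge1}^{k+\ell}$ with $|\vec t|=|\vec r|+|\vec s|$, put $h_i=r_j$ if $i=\varphi(j)$, $h_i=s_j$ if $i=\psi(j)$; $\varepsilon(i)=1$ if $i\in\mathrm{im}\,\varphi$ and $-1$ otherwise; $c(i)=\binom{t_i-1}{h_i-1}$ if $i=1$ or ($i\ge2$ and $\varepsilon(i)=\varepsilon(i-1)$), and $c(i)=\binom{t_i-1}{\sum_{j\le i}t_j-\sum_{j\le i}h_j}$ if $i\ge2$ and $\varepsilon(i)\neq\varepsilon(i-1)$, where for integers $a\ge0,b$, $\binom ab$ is the usual binomial coefficient if $0\le b\le a$ and $0$ otherwise; $c_{\vec r,\vec s}^{\vec t,(\varphi,\psi)}=\prod_{i=1}^{k+\ell}c(i)$. The vector $\vec w\,\overline{\sqcup\!\sqcup}_{(\varphi,\psi)}\vec z\in G^{k+\ell}$ has $i$-th entry: $w_j$ if $i=\varphi(j)$ and ($i=1$ or $i-1\in\mathrm{im}\,\varphi$); $z_j$ if $i=\psi(j)$ and ($i=1$ or $i-1\in\mathrm{im}\,\psi$); $\frac{w_1\cdots w_j}{z_1\cdots z_{i-j}}$ if $i=\varphi(j)$ and $i-1\in\mathrm{im}\,\psi$; $\frac{z_1\cdots z_j}{w_1\cdots w_{i-j}}$ if $i=\psi(j)$ and $i-1\in\mathrm{im}\,\varphi$. *)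

theory Defs
  imports "HOL-Algebra.Free_Abelian_Groups"
begin

text \<open>
  Free abelian groups are the library's \<open>free_Abelian_group S\<close>, whose elements have type
  \<open>'a \<Rightarrow>\<^sub>0 int\<close>; linear maps are given on basis elements and extended by \<open>frag_extend\<close>.
  Vectors of length \<open>n\<close> are functions used on the indices \<open>{1..n}\<close> only.
\<close>

definition vec_word :: "nat \<Rightarrow> (nat \<Rightarrow> nat) \<Rightarrow> (nat \<Rightarrow> 'g) \<Rightarrow> (nat \<times> 'g) list" where
  "vec_word n s b = map (\<lambda>i. (s i, b i)) [1..<Suc n]"

definition words_ZG :: "('g, 'm) monoid_scheme \<Rightarrow> (nat \<times> 'g) list set" where
  "words_ZG G = lists ({1..} \<times> carrier G)"

definition H_ZG :: "('g, 'm) monoid_scheme \<Rightarrow> ((nat \<times> 'g) list \<Rightarrow>\<^sub>0 int) set" where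
  "H_ZG G = carrier (free_Abelian_group (words_ZG G))"


datatype 'g letter = X0 | X 'g

fun shuffle_word :: "'x list \<Rightarrow> 'x list \<Rightarrow> ('x list \<Rightarrow>\<^sub>0 int)" where
  "shuffle_word [] w = frag_of w"
| "shuffle_word w [] = frag_of w"
| "shuffle_word (a # u) (b # v) =
     frag_extend (\<lambda>w. frag_of (a # w)) (shuffle_word u (b # v)) +
     frag_extend (\<lambda>w. frag_of (b # w)) (shuffle_word (a # u) v)"

definition shuffle :: "('x list \<Rightarrow>\<^sub>0 int) \<Rightarrow> ('x list \<Rightarrow>\<^sub>0 int) \<Rightarrow> ('x list \<Rightarrow>\<^sub>0 int)" where
  "shuffle p q = frag_extend (\<lambda>u. frag_extend (\<lambda>v. shuffle_word u v) q) p"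

definition words_H1 :: "('g, 'm) monoid_scheme \<Rightarrow> 'g letter list set" where
  "words_H1 G = {w \<in> lists (insert X0 (X ` carrier G)). w = [] \<or> (\<exists>b\<in>carrier G. last w = X b)}"

definition H1 :: "('g, 'm) monoid_scheme \<Rightarrow> ('g letter list \<Rightarrow>\<^sub>0 int) set" where
  "H1 G = carrier (free_Abelian_group (words_H1 G))"

text \<open>
  The recursion scans a word from the left; \<open>c\<close> is the index of the last letter \<open>X c\<close> already
  read (initially the unit of \<open>G\<close>) and \<open>n\<close> the number of letters \<open>X0\<close> read since. The closed
  form on basis words is lemma \<open>eta_word_basis_word\<close> below; trailing letters \<open>X0\<close>, which do not
  occur in \<open>words_H1\<close>, are dropped.
\<close>
fun eta_scan :: "('g, 'm) monoid_scheme \<Rightarrow> 'g \<Rightarrow> nat \<Rightarrow> 'g letter list \<Rightarrow> (nat \<times> 'g) list" where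
  "eta_scan G c n [] = []"
| "eta_scan G c n (X0 # w) = eta_scan G c (Suc n) w"
| "eta_scan G c n (X b # w) = (Suc n, c \<otimes>\<^bsub>G\<^esub> inv\<^bsub>G\<^esub> b) # eta_scan G b 0 w"

definition eta_word :: "('g, 'm) monoid_scheme \<Rightarrow> 'g letter list \<Rightarrow> (nat \<times> 'g) list" where
  "eta_word G w = eta_scan G \<one>\<^bsub>G\<^esub> 0 w"

definition eta ::
  "('g, 'm) monoid_scheme \<Rightarrow> ('g letter list \<Rightarrow>\<^sub>0 int) \<Rightarrow> ((nat \<times> 'g) list \<Rightarrow>\<^sub>0 int)" where
  "eta G = frag_extend (\<lambda>w. frag_of (eta_word G w))"

definition shuffle_eta ::
  "('g, 'm) monoid_scheme \<Rightarrow> ((nat \<times> 'g) list \<Rightarrow>\<^sub>0 int) \<Rightarrow> ((nat \<times> 'g) list \<Rightarrow>\<^sub>0 int)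
     \<Rightarrow> ((nat \<times> 'g) list \<Rightarrow>\<^sub>0 int)" where
  "shuffle_eta G u v = eta G (shuffle (inv_into (H1 G) (eta G) u) (inv_into (H1 G) (eta G) v))"


definition I_pairs :: "nat \<Rightarrow> nat \<Rightarrow> ((nat \<Rightarrow> nat) \<times> (nat \<Rightarrow> nat)) set" where
  "I_pairs k l = {(\<phi>, \<psi>).
     \<phi> \<in> {1..k} \<rightarrow>\<^sub>E {1..k+l} \<and> mono_on {1..k} \<phi> \<and> inj_on \<phi> {1..k} \<and>
     \<psi> \<in> {1..l} \<rightarrow>\<^sub>E {1..k+l} \<and> mono_on {1..l} \<psi> \<and> inj_on \<psi> {1..l} \<and>
     \<phi> ` {1..k} \<inter> \<psi> ` {1..l} = {} \<and> \<phi> ` {1..k} \<union> \<psi> ` {1..l} = {1..k+l}}"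

definition T_vecs :: "nat \<Rightarrow> nat \<Rightarrow> (nat \<Rightarrow> nat) \<Rightarrow> (nat \<Rightarrow> nat) \<Rightarrow> (nat \<Rightarrow> nat) set" where
  "T_vecs k l r s = {t \<in> {1..k+l} \<rightarrow>\<^sub>E {1..}. sum t {1..k+l} = sum r {1..k} + sum s {1..l}}"

definition binom :: "int \<Rightarrow> int \<Rightarrow> int" where
  "binom a b = (if 0 \<le> b \<and> b \<le> a then int (nat a choose nat b) else 0)"

definition h_entry ::
  "nat \<Rightarrow> nat \<Rightarrow> (nat \<Rightarrow> nat) \<Rightarrow> (nat \<Rightarrow> nat) \<Rightarrow> (nat \<Rightarrow> nat) \<Rightarrow> (nat \<Rightarrow> nat) \<Rightarrow> nat \<Rightarrow> nat" where
  "h_entry k l r s \<phi> \<psi> i =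
     (if i \<in> \<phi> ` {1..k} then r (inv_into {1..k} \<phi> i) else s (inv_into {1..l} \<psi> i))"

definition eps :: "nat \<Rightarrow> (nat \<Rightarrow> nat) \<Rightarrow> nat \<Rightarrow> int" where
  "eps k \<phi> i = (if i \<in> \<phi> ` {1..k} then 1 else -1)"

definition c_factor ::
  "nat \<Rightarrow> nat \<Rightarrow> (nat \<Rightarrow> nat) \<Rightarrow> (nat \<Rightarrow> nat) \<Rightarrow> (nat \<Rightarrow> nat) \<Rightarrow> (nat \<Rightarrow> nat) \<Rightarrow> (nat \<Rightarrow> nat)
     \<Rightarrow> nat \<Rightarrow> int" where
  "c_factor k l r s t \<phi> \<psi> i =
     (if i = 1 \<or> eps k \<phi> i = eps k \<phi> (i - 1)
      then binom (int (t i) - 1) (int (h_entry k l r s \<phi> \<psi> i) - 1)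
      else binom (int (t i) - 1)
             ((\<Sum>j=1..i. int (t j)) - (\<Sum>j=1..i. int (h_entry k l r s \<phi> \<psi> j))))"

definition c_coeff ::
  "nat \<Rightarrow> nat \<Rightarrow> (nat \<Rightarrow> nat) \<Rightarrow> (nat \<Rightarrow> nat) \<Rightarrow> (nat \<Rightarrow> nat) \<Rightarrow> (nat \<Rightarrow> nat) \<Rightarrow> (nat \<Rightarrow> nat)
     \<Rightarrow> int" where
  "c_coeff k l r s t \<phi> \<psi> = (\<Prod>i=1..k+l. c_factor k l r s t \<phi> \<psi> i)"

text \<open>
  For $(\varphi,\psi)$ in \<open>I_pairs k l\<close> the images partition $\{1,\dots,k+l\}$, so the two \<open>else\<close>
  branches below are exactly the cases in which $i - 1$ lies in the other image.
\<close>
definition bar_shuffle ::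
  "('g, 'm) monoid_scheme \<Rightarrow> nat \<Rightarrow> nat \<Rightarrow> (nat \<Rightarrow> nat) \<Rightarrow> (nat \<Rightarrow> nat)
     \<Rightarrow> (nat \<Rightarrow> 'g) \<Rightarrow> (nat \<Rightarrow> 'g) \<Rightarrow> nat \<Rightarrow> 'g" where
  "bar_shuffle G k l \<phi> \<psi> w z i =
     (if i \<in> \<phi> ` {1..k} then
        let j = inv_into {1..k} \<phi> i in
        if i = 1 \<or> i - 1 \<in> \<phi> ` {1..k} then w j
        else finprod G w {1..j} \<otimes>\<^bsub>G\<^esub> inv\<^bsub>G\<^esub> (finprod G z {1..i-j})
      else
        let j = inv_into {1..l} \<psi> i in
        if i = 1 \<or> i - 1 \<in> \<psi> ` {1..l} then z j
        else finprod G z {1..j} \<otimes>\<^bsub>G\<^esub> inv\<^bsub>G\<^esub> (finprod G w {1..i-j}))"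


text \<open>The word $x_0^{s_1-1}x_{b_1}\cdots x_0^{s_n-1}x_{b_n}$.\<close>
definition basis_word :: "nat \<Rightarrow> (nat \<Rightarrow> nat) \<Rightarrow> (nat \<Rightarrow> 'g) \<Rightarrow> 'g letter list" where
  "basis_word n s b = concat (map (\<lambda>i. replicate (s i - 1) X0 @ [X (b i)]) [1..<Suc n])"

lemma eta_scan_replicate: "eta_scan G c n (replicate m X0 @ w) = eta_scan G c (n + m) w"
  by (induction m arbitrary: n) auto

lemma eta_scan_blocks:
  assumes "\<And>i. m \<le> i \<Longrightarrow> i < m + d \<Longrightarrow> 1 \<le> s i"
  shows "eta_scan G c 0 (concat (map (\<lambda>i. replicate (s i - 1) X0 @ [X (b i)]) [m..<m + d])) =
    map (\<lambda>i. (s i, (if i = m then c else b (i - 1)) \<otimes>\<^bsub>G\<^esub> inv\<^bsub>G\<^esub> (b i))) [m..<m + d]"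
  using assms
proof (induction d arbitrary: m c)
  case 0
  then show ?case by simp
next
  case (Suc d)
  have IH: "eta_scan G (b m) 0
      (concat (map (\<lambda>i. replicate (s i - 1) X0 @ [X (b i)]) [Suc m..<Suc m + d])) =
    map (\<lambda>i. (s i, (if i = Suc m then b m else b (i - 1)) \<otimes>\<^bsub>G\<^esub> inv\<^bsub>G\<^esub> (b i))) [Suc m..<Suc m + d]"
    using Suc.prems by (intro Suc.IH) auto
  have "1 \<le> s m" using Suc.prems by auto
  moreover have "[m..<m + Suc d] = m # [Suc m..<Suc m + d]"
    using upt_conv_Cons[of m "m + Suc d"] by simp
  ultimately show ?case
    by (simp only: list.map concat.simps append_assoc eta_scan_replicate append_Cons
          append_Nil eta_scan.simps IH) auto
qed

lemma eta_word_basis_word: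
  assumes "\<And>i. i \<in> {1..n} \<Longrightarrow> 1 \<le> s i"
  shows "eta_word G (basis_word n s b) =
    vec_word n s (\<lambda>i. (if i = 1 then \<one>\<^bsub>G\<^esub> else b (i - 1)) \<otimes>\<^bsub>G\<^esub> inv\<^bsub>G\<^esub> (b i))"
  using eta_scan_blocks[of 1 n s G "\<one>\<^bsub>G\<^esub>" b] assms
  by (auto simp: eta_word_def basis_word_def vec_word_def)

lemma bij_betw_frag_extend:
  assumes "bij_betw f A B"
  shows "bij_betw (frag_extend (\<lambda>w. frag_of (f w)))
    (carrier (free_Abelian_group A)) (carrier (free_Abelian_group B))"
proof -
  define g where "g = inv_into A f"
  have gf: "g (f x) = x" if "x \<in> A" for x
    using assms that by (simp add: g_def bij_betw_inv_into_left)
  have fg: "f (g y) = y" if "y \<in> B" for y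
    using assms that by (simp add: g_def bij_betw_inv_into_right)
  have fA: "f x \<in> B" if "x \<in> A" for x
    using assms that bij_betwE by blast
  have gB: "g y \<in> A" if "y \<in> B" for y
    using assms that unfolding g_def by (metis bij_betwE bij_betw_inv_into)
  have o: "(\<lambda>w. frag_of (f w)) = frag_of \<circ> f" "(\<lambda>w. frag_of (g w)) = frag_of \<circ> g"
    by auto
  show ?thesis
  proof (rule bij_betw_byWitness[where f' = "frag_extend (\<lambda>w. frag_of (g w))"])
    show "\<forall>a\<in>carrier (free_Abelian_group A).
        frag_extend (\<lambda>w. frag_of (g w)) (frag_extend (\<lambda>w. frag_of (f w)) a) = a"
    proof
      fix a assume a: "a \<in> carrier (free_Abelian_group A)"
      have "frag_extend ((\<lambda>w. frag_of (g w)) \<circ> f) a = frag_extend frag_of a"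
        using a gf by (intro frag_extend_eq) auto
      then show "frag_extend (\<lambda>w. frag_of (g w)) (frag_extend (\<lambda>w. frag_of (f w)) a) = a"
        unfolding o(1) frag_extend_compose by (simp flip: frag_expansion)
    qed
    show "\<forall>a\<in>carrier (free_Abelian_group B).
        frag_extend (\<lambda>w. frag_of (f w)) (frag_extend (\<lambda>w. frag_of (g w)) a) = a"
    proof
      fix a assume a: "a \<in> carrier (free_Abelian_group B)"
      have "frag_extend ((\<lambda>w. frag_of (f w)) \<circ> g) a = frag_extend frag_of a"
        using a fg by (intro frag_extend_eq) auto
      then show "frag_extend (\<lambda>w. frag_of (f w)) (frag_extend (\<lambda>w. frag_of (g w)) a) = a"
        unfolding o(2) frag_extend_compose by (simp flip: frag_expansion)
    qed
    show "frag_extend (\<lambda>w. frag_of (f w)) ` carrier (free_Abelian_group A)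
        \<subseteq> carrier (free_Abelian_group B)"
      using fA by (fastforce dest!: subsetD[OF keys_frag_extend])
    show "frag_extend (\<lambda>w. frag_of (g w)) ` carrier (free_Abelian_group B)
        \<subseteq> carrier (free_Abelian_group A)"
      using gB by (fastforce dest!: subsetD[OF keys_frag_extend])
  qed
qed

fun eta_unscan :: "('g, 'm) monoid_scheme \<Rightarrow> 'g \<Rightarrow> (nat \<times> 'g) list \<Rightarrow> 'g letter list" where
  "eta_unscan G c [] = []"
| "eta_unscan G c ((s, a) # p) =
     replicate (s - 1) X0 @ X (c \<otimes>\<^bsub>G\<^esub> inv\<^bsub>G\<^esub> a) # eta_unscan G (c \<otimes>\<^bsub>G\<^esub> inv\<^bsub>G\<^esub> a) p"

context comm_group
begin

lemma div_div_cancel: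
  assumes "c \<in> carrier G" "a \<in> carrier G"
  shows "c \<otimes> inv (c \<otimes> inv a) = a"
  using assms by (simp add: inv_mult m_assoc[symmetric])

lemma eta_unscan_scan:
  assumes "w \<in> words_H1 G" "c \<in> carrier G" "w \<noteq> [] \<or> n = 0"
  shows "eta_unscan G c (eta_scan G c n w) = replicate n X0 @ w"
  using assms
proof (induction w arbitrary: c n)
  case (Cons x w)
  show ?case
  proof (cases x)
    case X0
    with Cons.prems have "w \<noteq> []" "w \<in> words_H1 G" by (auto simp: words_H1_def)
    with Cons.IH[of c "Suc n"] Cons.prems X0 show ?thesis
      by (simp add: replicate_app_Cons_same)
  next
    case (X b)
    with Cons.prems have "b \<in> carrier G" "w \<in> words_H1 G"
      by (auto simp: words_H1_def split: if_splits)
    with Cons.IH[of b 0] Cons.prems X show ?thesis by (simp add: div_div_cancel)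
  qed
qed simp

lemma eta_scan_unscan:
  assumes "p \<in> words_ZG G" "c \<in> carrier G"
  shows "eta_scan G c 0 (eta_unscan G c p) = p"
  using assms
  by (induction p arbitrary: c)
     (auto simp: words_ZG_def eta_scan_replicate div_div_cancel)

lemma eta_scan_closed:
  assumes "w \<in> words_H1 G" "c \<in> carrier G"
  shows "eta_scan G c n w \<in> words_ZG G"
  using assms
proof (induction w arbitrary: c n)
  case Nil
  then show ?case by (simp add: words_ZG_def)
next
  case (Cons x w)
  have w: "w \<in> words_H1 G" using Cons.prems by (auto simp: words_H1_def split: if_splits)
  show ?case
  proof (cases x)
    case X0
    with Cons.IH[OF w] Cons.prems show ?thesis by simp
  next
    case (X b)
    with Cons.prems have "b \<in> carrier G" by (auto simp: words_H1_def)
    with Cons.IH[OF w, of b 0] Cons.prems X show ?thesis by (simp add: words_ZG_def)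
  qed
qed

lemma eta_unscan_closed:
  assumes "p \<in> words_ZG G" "c \<in> carrier G"
  shows "eta_unscan G c p \<in> words_H1 G"
  using assms
proof (induction p arbitrary: c)
  case Nil
  then show ?case by (simp add: words_H1_def)
next
  case (Cons x p)
  obtain s a where x: "x = (s, a)" by force
  with Cons.prems have a: "a \<in> carrier G" "p \<in> words_ZG G" by (auto simp: words_ZG_def)
  with Cons.IH[OF a(2), of "c \<otimes> inv a"] Cons.prems(2) show ?case
    by (auto simp: x words_H1_def)
qed

lemma bij_betw_eta_word: "bij_betw (eta_word G) (words_H1 G) (words_ZG G)"
  by (rule bij_betw_byWitness[where f' = "eta_unscan G \<one>"])
     (auto simp: eta_word_def eta_unscan_scan eta_scan_unscan eta_scan_closed eta_unscan_closed)

lemma bij_betw_eta: "bij_betw (eta G) (H1 G) (H_ZG G)"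
  unfolding eta_def H1_def H_ZG_def by (rule bij_betw_frag_extend[OF bij_betw_eta_word])

end

lemma finite_I_pairs: "finite (I_pairs k l)"
  by (rule finite_subset[of _ "({1..k} \<rightarrow>\<^sub>E {1..k+l}) \<times> ({1..l} \<rightarrow>\<^sub>E {1..k+l})"])
     (auto simp: I_pairs_def intro!: finite_PiE)

lemma finite_T_vecs: "finite (T_vecs k l r s)"
proof -
  define N where "N = sum r {1..k} + sum s {1..l}"
  have "T_vecs k l r s \<subseteq> {1..k+l} \<rightarrow>\<^sub>E {..N}"
  proof
    fix t assume t: "t \<in> T_vecs k l r s"
    have "t i \<le> N" if "i \<in> {1..k+l}" for i
      using t member_le_sum[of i "{1..k+l}" t] that by (auto simp: T_vecs_def N_def)
    with t show "t \<in> {1..k+l} \<rightarrow>\<^sub>E {..N}"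
      by (auto simp: T_vecs_def PiE_def Pi_def)
  qed
  then show ?thesis by (rule finite_subset) (auto intro!: finite_PiE)
qed

end

theory Submission
  imports Defs
begin

text \<open>
  Read a word of the shuffle product from the left, block by block, where a block
  $x_0^{t-1} x_b$ ends in a letter other than $x_0$. If the two factors start with $x_0^m x_a$ and
  $x_0^n x_b$ and the first such letter is $x_a$, then the first block uses up $p \<le> n$ of
  the letters $x_0$ of the second factor, which is possible in $\binom{m+p}{m}$ ways, and
  the rest is a shuffle of the remaining words. Iterating, the product is a sum over the
  arrangements of the letters other than $x_0$ and over the block lengths $t$ of products of
  binomial coefficients $\binom{t_i-1}{m_i}$, where $m_i$ is the number of letters $x_0$ that
  are left in the block completed at step $i$. At that moment the completed blocks have total length
  $\sum_{j<i} h_j$, and $\sum_{j<i} (t_j - h_j)$ is the number of letters already used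
  from the incomplete block. So $m_i = h_i - 1$ if the previous letter came from the same factor and
  $m_i = h_i - 1 - \sum_{j<i} (t_j - h_j)$ otherwise, which gives $c(i)$ by the symmetry of
  the binomial coefficients. Tuples with an overdrawn block have coefficient $0$.
\<close>

section \<open>Shuffling two blocks\<close>

definition prepend :: "'x list \<Rightarrow> ('x list \<Rightarrow>\<^sub>0 int) \<Rightarrow> ('x list \<Rightarrow>\<^sub>0 int)" where
  "prepend u = frag_extend (\<lambda>w. frag_of (u @ w))"

lemma prepend_simps [simp]:
  "prepend u 0 = 0"
  "prepend u (frag_of w) = frag_of (u @ w)"
  "prepend u (p + q) = prepend u p + prepend u q"
  "prepend u (frag_cmul c p) = frag_cmul c (prepend u p)"
  by (simp_all add: prepend_def frag_extend_add frag_extend_cmul)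

lemma prepend_sum: "prepend u (sum f A) = (\<Sum>i\<in>A. prepend u (f i))"
  by (induction A rule: infinite_finite_induct) simp_all

lemma prepend_prepend: "prepend u (prepend v p) = prepend (u @ v) p"
proof -
  have "frag_extend (\<lambda>w. frag_of (v @ w)) = frag_extend (frag_of \<circ> (\<lambda>w. v @ w))"
    by (simp add: comp_def)
  then show ?thesis
    unfolding prepend_def by (simp only: frag_extend_compose) (simp add: comp_def)
qed

lemma shuffle_word_Nil [simp]: "shuffle_word w [] = frag_of w"
  by (cases w) simp_all

lemma shuffle_word_Cons:
  "shuffle_word (a # u) (b # v) =
     prepend [a] (shuffle_word u (b # v)) + prepend [b] (shuffle_word (a # u) v)"
  by (simp add: prepend_def)

text \<open>Collects the shuffles of \<open>x^m a u\<close> and \<open>x^n b v\<close> in which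
  \<open>a\<close> comes before \<open>b\<close>: if \<open>p\<close> letters \<open>x\<close> of
  the second word precede \<open>a\<close>, they interleave with the \<open>m\<close> of the first
  in \<open>m + p choose m\<close> ways, and \<open>F (n - p)\<close> is the product of the
  remainders.\<close>

definition block_sum :: "'x \<Rightarrow> 'x \<Rightarrow> (nat \<Rightarrow> ('x list \<Rightarrow>\<^sub>0 int)) \<Rightarrow> nat \<Rightarrow> nat \<Rightarrow> ('x list \<Rightarrow>\<^sub>0 int)" where
  "block_sum x a F m n =
     (\<Sum>p\<le>n. frag_cmul (int (m + p choose m)) (prepend (replicate (m + p) x @ [a]) (F (n - p))))"

lemma block_sum_0_0: "block_sum x a F 0 0 = prepend [a] (F 0)"
  by (simp add: block_sum_def)

lemma block_sum_0_Suc: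
  "block_sum x a F 0 (Suc n) = prepend [a] (F (Suc n)) + prepend [x] (block_sum x a F 0 n)"
  by (simp add: block_sum_def sum.atMost_Suc_shift prepend_sum prepend_prepend del: sum.atMost_Suc)

lemma block_sum_Suc_0: "block_sum x a F (Suc m) 0 = prepend [x] (block_sum x a F m 0)"
  by (simp add: block_sum_def prepend_prepend)

text \<open>Pascal's rule: the first letter \<open>x\<close> comes from the first or from the second
  word.\<close>

lemma block_sum_Suc_Suc:
  "block_sum x a F (Suc m) (Suc n) =
     prepend [x] (block_sum x a F m (Suc n)) + prepend [x] (block_sum x a F (Suc m) n)"
  by (simp add: block_sum_def sum.atMost_Suc_shift prepend_sum prepend_prepend
      frag_cmul_distrib sum.distrib algebra_simps del: sum.atMost_Suc)

text \<open>Sort the words of the product by the first letter other than the padding letter \<open>x\<close>.\<close>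
lemma shuffle_word_blocks:
  "shuffle_word (replicate m x @ a # u) (replicate n x @ b # v) =
     block_sum x a (\<lambda>i. shuffle_word u (replicate i x @ b # v)) m n +
     block_sum x b (\<lambda>i. shuffle_word (replicate i x @ a # u) v) n m"
\<comment> \<open>Both sides are compared by their first letter: a leading \<open>x\<close> matches
  the recursions of \<open>block_sum\<close>, a leading \<open>a\<close> or \<open>b\<close> its
  summand with \<open>p = 0\<close>.\<close>
proof (induction m arbitrary: n)
  case 0
  show ?case
    by (induction n) (simp_all add: shuffle_word_Cons block_sum_0_0 block_sum_0_Suc block_sum_Suc_0
        add_ac del: shuffle_word.simps(3))
next
  case (Suc m)
  note IH = Suc.IH
  show ?case
  proof (induction n)
    case 0
    show ?case using IH[of 0]
      by (simp add: shuffle_word_Cons block_sum_0_Suc block_sum_Suc_0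
          add_ac del: shuffle_word.simps(3))
  next
    case (Suc n)
    then show ?case using IH[of "Suc n"]
      by (simp add: shuffle_word_Cons block_sum_Suc_Suc add_ac del: shuffle_word.simps(3))
  qed
qed

section \<open>Expansion over patterns and compositions\<close>

text \<open>\<open>True\<close> marks the positions filled from the first factor. This list form of
  a pair (\<phi>, \<psi>) admits recursion on the first position.\<close>

definition patterns :: "nat \<Rightarrow> nat \<Rightarrow> bool list set" where
  "patterns k l = {\<sigma>. length (filter (\<lambda>x. x) \<sigma>) = k \<and> length (filter Not \<sigma>) = l}"

lemma Nil_in_patterns [simp]: "[] \<in> patterns k l \<longleftrightarrow> k = 0 \<and> l = 0"
  by (auto simp: patterns_def)

lemma Cons_in_patterns [simp]:
  "x # \<sigma> \<in> patterns k l \<longleftrightarrow>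
     (if x then \<exists>k'. k = Suc k' \<and> \<sigma> \<in> patterns k' l else \<exists>l'. l = Suc l' \<and> \<sigma> \<in> patterns k l')"
  by (auto simp: patterns_def)

lemma length_pattern: "\<sigma> \<in> patterns k l \<Longrightarrow> length \<sigma> = k + l"
  using sum_length_filter_compl[of "\<lambda>x. x" \<sigma>] by (auto simp: patterns_def)

lemma finite_patterns [simp]: "finite (patterns k l)"
proof (rule finite_subset)
  show "patterns k l \<subseteq> {\<sigma>. set \<sigma> \<subseteq> UNIV \<and> length \<sigma> = k + l}"
    by (auto simp: length_pattern)
qed (rule finite_lists_length_eq, simp)

lemma patterns_0_0: "patterns 0 0 = {[]}"
  using length_pattern[of _ 0 0] by fastforce

lemma patterns_Suc_0: "patterns (Suc k) 0 = (#) True ` patterns k 0"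
proof (intro Set.set_eqI)
  fix \<sigma> show "\<sigma> \<in> patterns (Suc k) 0 \<longleftrightarrow> \<sigma> \<in> (#) True ` patterns k 0" by (cases \<sigma>) auto
qed

lemma patterns_0_Suc: "patterns 0 (Suc l) = (#) False ` patterns 0 l"
proof (intro Set.set_eqI)
  fix \<sigma> show "\<sigma> \<in> patterns 0 (Suc l) \<longleftrightarrow> \<sigma> \<in> (#) False ` patterns 0 l" by (cases \<sigma>) auto
qed

lemma patterns_Suc_Suc:
  "patterns (Suc k) (Suc l) = (#) True ` patterns k (Suc l) \<union> (#) False ` patterns (Suc k) l"
proof (intro Set.set_eqI)
  fix \<sigma>
  show "\<sigma> \<in> patterns (Suc k) (Suc l) \<longleftrightarrow>
    \<sigma> \<in> (#) True ` patterns k (Suc l) \<union> (#) False ` patterns (Suc k) l"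
    by (cases \<sigma>) auto
qed

text \<open>Compositions of \<open>N\<close> into \<open>n\<close> parts, the list form of
  \<open>T_vecs\<close>.\<close>

definition comps :: "nat \<Rightarrow> nat \<Rightarrow> nat list set" where
  "comps n N = {ts. length ts = n \<and> (\<forall>t\<in>set ts. 1 \<le> t) \<and> sum_list ts = N}"

lemma finite_comps [simp]: "finite (comps n N)"
proof (rule finite_subset)
  show "comps n N \<subseteq> {ts. set ts \<subseteq> {..N} \<and> length ts = n}"
    by (auto simp: comps_def member_le_sum_list)
qed (rule finite_lists_length_eq, simp)

lemma comps_0: "comps 0 N = (if N = 0 then {[]} else {})"
  by (auto simp: comps_def)

lemma sum_comps_Suc:
  "sum f (comps (Suc n) N) = (\<Sum>t\<in>{1..N}. \<Sum>ts\<in>comps n (N - t). f (t # ts))"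
proof -
  have "comps (Suc n) N = (\<lambda>(t, ts). t # ts) ` Sigma {1..N} (\<lambda>t. comps n (N - t))"
    by (auto simp: comps_def length_Suc_conv image_iff)
  moreover have "inj_on (\<lambda>(t, ts). t # ts) (Sigma {1..N} (\<lambda>t. comps n (N - t)))"
    by (auto simp: inj_on_def)
  ultimately show ?thesis
    by (simp add: sum.reindex sum.Sigma case_prod_unfold)
qed

text \<open>The last equation covers the empty pattern and, as a default, mismatched lengths, which
  do not occur for a pattern in \<open>patterns (length xs) (length ys)\<close>.\<close>

fun interleave :: "bool list \<Rightarrow> 'a list \<Rightarrow> 'a list \<Rightarrow> 'a list" where
  "interleave (True # \<sigma>) (x # xs) ys = x # interleave \<sigma> xs ys"
| "interleave (False # \<sigma>) xs (y # ys) = y # interleave \<sigma> xs ys"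
| "interleave _ _ _ = []"

text \<open>
  \<open>shuffle_mult \<sigma> ts ms ns\<close> counts the shuffles of the words with blocks of \<open>ms\<close>, respectively \<open>ns\<close>,
  letters \<open>X0\<close> that lead to the blocks \<open>ts\<close> (where \<open>t\<close> includes the final letter of the block) and
  in which the other letters are arranged according to \<open>\<sigma>\<close>.
\<close>
fun shuffle_mult :: "bool list \<Rightarrow> nat list \<Rightarrow> nat list \<Rightarrow> nat list \<Rightarrow> int" where
  "shuffle_mult [] [] [] [] = 1"
| "shuffle_mult (True # \<sigma>) (t # ts) (m # ms) [] = (if t = Suc m then shuffle_mult \<sigma> ts ms [] else 0)"
| "shuffle_mult (False # \<sigma>) (t # ts) [] (n # ns) = (if t = Suc n then shuffle_mult \<sigma> ts [] ns else 0)"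
| "shuffle_mult (True # \<sigma>) (t # ts) (m # ms) (n # ns) =
     (if Suc m \<le> t \<and> t \<le> Suc (m + n)
      then int (t - 1 choose m) * shuffle_mult \<sigma> ts ms ((m + n + 1 - t) # ns) else 0)"
| "shuffle_mult (False # \<sigma>) (t # ts) (m # ms) (n # ns) =
     (if Suc n \<le> t \<and> t \<le> Suc (n + m)
      then int (t - 1 choose n) * shuffle_mult \<sigma> ts ((n + m + 1 - t) # ms) ns else 0)"
| "shuffle_mult _ _ _ _ = 0"

text \<open>Here \<open>m\<close> counts the letters \<open>X0\<close> only, so that a block
  \<open>(m, a)\<close> belongs to a vector entry \<open>m + 1\<close>.\<close>

definition blocks :: "(nat \<times> 'g) list \<Rightarrow> 'g letter list" where
  "blocks us = concat (map (\<lambda>(m, a). replicate m X0 @ [X a]) us)"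

lemma blocks_simps [simp]:
  "blocks [] = []"
  "blocks ((m, a) # us) = replicate m X0 @ X a # blocks us"
  by (simp_all add: blocks_def)

text \<open>The length of the word \<open>blocks us\<close>; the successor accounts for the final
  letter of a block.\<close>

definition weight :: "(nat \<times> 'g) list \<Rightarrow> nat" where
  "weight us = (\<Sum>u\<leftarrow>us. Suc (fst u))"

lemma weight_simps [simp]: "weight [] = 0" "weight (u # us) = Suc (fst u) + weight us"
  by (simp_all add: weight_def)

definition pattern_term ::
  "(nat \<times> 'g) list \<Rightarrow> (nat \<times> 'g) list \<Rightarrow> bool list \<Rightarrow> nat list \<Rightarrow> ('g letter list \<Rightarrow>\<^sub>0 int)" where
  "pattern_term us vs \<sigma> ts = frag_cmul (shuffle_mult \<sigma> ts (map fst us) (map fst vs))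
     (frag_of (blocks (zip (map (\<lambda>t. t - 1) ts) (interleave \<sigma> (map snd us) (map snd vs)))))"

definition pattern_sum ::
  "(nat \<times> 'g) list \<Rightarrow> (nat \<times> 'g) list \<Rightarrow> ('g letter list \<Rightarrow>\<^sub>0 int)" where
  "pattern_sum us vs = (\<Sum>\<sigma>\<in>patterns (length us) (length vs).
     \<Sum>ts\<in>comps (length us + length vs) (weight us + weight vs). pattern_term us vs \<sigma> ts)"

section \<open>The recursion of the sum over patterns\<close>

lemma sum_single:
  assumes "finite A" "a \<in> A" "\<And>x. x \<in> A \<Longrightarrow> x \<noteq> a \<Longrightarrow> f x = 0"
  shows "sum f A = f a"
  using assms by (metis (mono_tags, lifting) DiffD1 DiffD2 insert_iff sum.remove sum.neutral add.right_neutral)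

text \<open>With the second factor exhausted nothing can lengthen the first block:
  \<open>shuffle_mult\<close> vanishes unless \<open>t = Suc m\<close>, and one summand over
  \<open>t\<close> survives.\<close>

lemma pattern_sum_Cons_Nil:
  "pattern_sum ((m, a) # us) [] = prepend (replicate m X0 @ [X a]) (pattern_sum us [])"
proof -
  have "pattern_sum ((m, a) # us) [] = (\<Sum>\<sigma>\<in>patterns (length us) 0.
     \<Sum>t\<in>{1..Suc (m + weight us)}. \<Sum>ts\<in>comps (length us) (Suc (m + weight us) - t).
       pattern_term ((m, a) # us) [] (True # \<sigma>) (t # ts))"
    by (simp add: pattern_sum_def patterns_Suc_0 sum.reindex sum_comps_Suc)
  also have "\<dots> = (\<Sum>\<sigma>\<in>patterns (length us) 0. \<Sum>ts\<in>comps (length us) (weight us).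
       pattern_term ((m, a) # us) [] (True # \<sigma>) (Suc m # ts))"
    by (subst sum_single[where a = "Suc m"]) (auto simp: pattern_term_def)
  also have "\<dots> = prepend (replicate m X0 @ [X a]) (pattern_sum us [])"
    by (simp add: pattern_sum_def prepend_sum pattern_term_def)
  finally show ?thesis .
qed

lemma pattern_sum_Nil_Cons:
  "pattern_sum [] ((m, a) # us) = prepend (replicate m X0 @ [X a]) (pattern_sum [] us)"
proof -
  have "pattern_sum [] ((m, a) # us) = (\<Sum>\<sigma>\<in>patterns 0 (length us).
     \<Sum>t\<in>{1..Suc (m + weight us)}. \<Sum>ts\<in>comps (length us) (Suc (m + weight us) - t).
       pattern_term [] ((m, a) # us) (False # \<sigma>) (t # ts))"
    by (simp add: pattern_sum_def patterns_0_Suc sum.reindex sum_comps_Suc)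
  also have "\<dots> = (\<Sum>\<sigma>\<in>patterns 0 (length us). \<Sum>ts\<in>comps (length us) (weight us).
       pattern_term [] ((m, a) # us) (False # \<sigma>) (Suc m # ts))"
    by (subst sum_single[where a = "Suc m"]) (auto simp: pattern_term_def)
  also have "\<dots> = prepend (replicate m X0 @ [X a]) (pattern_sum [] us)"
    by (simp add: pattern_sum_def prepend_sum pattern_term_def)
  finally show ?thesis .
qed

text \<open>Passes from the length \<open>t\<close> of the first block to the number
  \<open>p\<close> of letters \<open>X0\<close> that it takes from the other factor.\<close>

lemma sum_window:
  fixes f :: "nat \<Rightarrow> 'a::comm_monoid_add"
  assumes "Suc (m + n) \<le> N" "\<And>t. \<not> (Suc m \<le> t \<and> t \<le> Suc (m + n)) \<Longrightarrow> f t = 0"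
  shows "sum f {1..N} = (\<Sum>p\<le>n. f (Suc (m + p)))"
proof -
  have "sum f {1..N} = sum f {Suc m..Suc (m + n)}"
    using assms by (intro sum.mono_neutral_right) auto
  also have "{Suc m..Suc (m + n)} = (\<lambda>p. Suc (m + p)) ` {..n}"
  proof (intro Set.set_eqI iffI)
    fix t assume "t \<in> {Suc m..Suc (m + n)}"
    then show "t \<in> (\<lambda>p. Suc (m + p)) ` {..n}" by (intro image_eqI[of _ _ "t - Suc m"]) auto
  qed auto
  finally show ?thesis by (simp add: sum.reindex inj_on_def)
qed

text \<open>The same recursion as in \<open>shuffle_word_blocks\<close>: the first entry of the
  pattern tells which factor completes the first block, and the range of \<open>t\<close> where
  \<open>shuffle_mult\<close> can be nonzero yields the two block sums.\<close>

lemma pattern_sum_Cons_Cons: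
  "pattern_sum ((m, a) # us) ((n, b) # vs) =
     block_sum X0 (X a) (\<lambda>i. pattern_sum us ((i, b) # vs)) m n +
     block_sum X0 (X b) (\<lambda>i. pattern_sum ((i, a) # us) vs) n m"
proof -
  define N where "N = weight ((m, a) # us) + weight ((n, b) # vs)"
  define f where "f = pattern_term ((m, a) # us) ((n, b) # vs)"
  define k l where "k = length us" and "l = length vs"
  have "pattern_sum ((m, a) # us) ((n, b) # vs) =
    (\<Sum>\<sigma>\<in>patterns k (Suc l). \<Sum>ts\<in>comps (Suc (k + Suc l)) N. f (True # \<sigma>) ts) +
    (\<Sum>\<sigma>\<in>patterns (Suc k) l. \<Sum>ts\<in>comps (Suc (Suc k + l)) N. f (False # \<sigma>) ts)"
    unfolding pattern_sum_def N_def[symmetric] f_def[symmetric] k_def l_def length_Cons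
      patterns_Suc_Suc
    by (subst sum.union_disjoint) (auto simp: sum.reindex)
  moreover have "(\<Sum>\<sigma>\<in>patterns k (Suc l). \<Sum>ts\<in>comps (Suc (k + Suc l)) N. f (True # \<sigma>) ts) =
    block_sum X0 (X a) (\<lambda>i. pattern_sum us ((i, b) # vs)) m n"
  proof -
    \<comment> \<open>For \<open>t = Suc (m + p)\<close> the other factor keeps \<open>n - p\<close>
      letters \<open>X0\<close> in its first block; the remaining multiplicity and the remaining
      weight are those of this shortened list.\<close>
    have "(\<Sum>ts\<in>comps (Suc (k + Suc l)) N. f (True # \<sigma>) ts) =
      (\<Sum>p\<le>n. frag_cmul (int (m + p choose m)) (prepend (replicate (m + p) X0 @ [X a])
        (\<Sum>ts\<in>comps (k + Suc l) (weight us + weight ((n - p, b) # vs)).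
           pattern_term us ((n - p, b) # vs) \<sigma> ts)))" for \<sigma>
      unfolding sum_comps_Suc
      by (subst sum_window[of m n])
         (auto simp: N_def f_def pattern_term_def prepend_sum frag_cmul_sum
           intro!: sum.cong arg_cong[of _ _ "comps _"])
    then show ?thesis
      by (simp add: block_sum_def pattern_sum_def k_def l_def prepend_sum frag_cmul_sum)
        (rule sum.swap)
  qed
  moreover have "(\<Sum>\<sigma>\<in>patterns (Suc k) l. \<Sum>ts\<in>comps (Suc (Suc k + l)) N. f (False # \<sigma>) ts) =
    block_sum X0 (X b) (\<lambda>i. pattern_sum ((i, a) # us) vs) n m"
  proof -
    have "(\<Sum>ts\<in>comps (Suc (Suc k + l)) N. f (False # \<sigma>) ts) =
      (\<Sum>p\<le>m. frag_cmul (int (n + p choose n)) (prepend (replicate (n + p) X0 @ [X b])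
        (\<Sum>ts\<in>comps (Suc k + l) (weight ((m - p, a) # us) + weight vs).
           pattern_term ((m - p, a) # us) vs \<sigma> ts)))" for \<sigma>
      unfolding sum_comps_Suc
      by (subst sum_window[of n m])
         (auto simp: N_def f_def pattern_term_def prepend_sum frag_cmul_sum
           intro!: sum.cong arg_cong[of _ _ "comps _"])
    then show ?thesis
      by (simp add: block_sum_def pattern_sum_def k_def l_def prepend_sum frag_cmul_sum)
        (rule sum.swap)
  qed
  ultimately show ?thesis by simp
qed

text \<open>Both sides obey the same recursion. One step removes a block from one list but changes
  the head of the other, hence the induction on the total number of blocks with both lists
  arbitrary.\<close>

lemma shuffle_word_eq_pattern_sum:
  fixes us vs :: "(nat \<times> 'g) list"
  shows "shuffle_word (blocks us) (blocks vs) = pattern_sum us vs"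
proof (induction "length us + length vs" arbitrary: us vs rule: less_induct)
  case less
  have IH: "pattern_sum us' vs' = shuffle_word (blocks us') (blocks vs')"
    if "length us' + length vs' < length us + length vs" for us' vs' :: "(nat \<times> 'g) list"
    using that by (rule less[symmetric])
  show ?case
  proof (cases us)
    case Nil
    show ?thesis
    proof (cases vs)
      case Nil
      with \<open>us = []\<close> show ?thesis
        by (simp add: pattern_sum_def patterns_0_0 comps_0 pattern_term_def)
    next
      case (Cons v vs')
      with \<open>us = []\<close> show ?thesis
        by (cases v) (simp add: pattern_sum_Nil_Cons IH)
    qed
  next
    case (Cons u us')
    show ?thesis
    proof (cases vs)
      case Nil
      with Cons show ?thesis
        by (cases u) (simp add: pattern_sum_Cons_Nil IH)
    next
      case (Cons v vs')
      with \<open>us = u # us'\<close> show ?thesis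
        by (cases u; cases v) (simp add: pattern_sum_Cons_Cons IH shuffle_word_blocks)
    qed
  qed
qed

section \<open>The coefficients\<close>

text \<open>
  The product of the factors $c(i)$ over a final segment of indices: \<open>prev\<close> and \<open>e\<close> record
  $\varepsilon(i-1)$ and $\sum_{j<i} (t_j - h_j)$ for its first index $i$.
\<close>
fun coeff :: "bool \<Rightarrow> int \<Rightarrow> bool list \<Rightarrow> nat list \<Rightarrow> nat list \<Rightarrow> int" where
  "coeff prev e (x # \<sigma>) (h # hs) (t # ts) =
     (if x = prev then binom (int t - 1) (int h - 1) else binom (int t - 1) (e + int t - int h)) *
     coeff x (e + int t - int h) \<sigma> hs ts"
| "coeff prev e _ _ _ = 1"

text \<open>Turns block lengths into numbers of letters \<open>X0\<close>, when \<open>e\<close>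
  letters of the first block are already used.\<close>

fun shorten :: "nat \<Rightarrow> nat list \<Rightarrow> nat list" where
  "shorten e [] = []"
| "shorten e (h # hs) = (h - 1 - e) # map (\<lambda>h. h - 1) hs"

lemma shorten_0 [simp]: "shorten 0 hs = map (\<lambda>h. h - 1) hs"
  by (cases hs) simp_all

text \<open>An overdrawn block of the other word can never be completed.\<close>
lemma coeff_overdrawn:
  assumes "\<sigma> \<in> patterns (length rs) (length ss)" "length ts = length \<sigma>" "\<forall>t\<in>set ts. 1 \<le> t"
    and "if prev then ss \<noteq> [] \<and> int (hd ss) \<le> e else rs \<noteq> [] \<and> int (hd rs) \<le> e"
  shows "coeff prev e \<sigma> (interleave \<sigma> rs ss) ts = 0"
  using assms
proof (induction \<sigma> arbitrary: prev e rs ss ts)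
  case Nil
  then show ?case by (auto split: if_splits)
next
  case (Cons x \<sigma>)
  obtain t ts' where ts: "ts = t # ts'" using Cons.prems by (cases ts) auto
  show ?case
  proof (cases x)
    case True
    then obtain h rs' where rs: "rs = h # rs'" using Cons.prems by (cases rs) auto
    \<comment> \<open>If the factor does not change, either \<open>t < h\<close> and the binomial is
      0, or the excess stays at least \<open>e\<close> and the induction hypothesis applies. If it
      changes, the lower entry \<open>e + t - h\<close> is at least \<open>t\<close>, so the
      binomial is 0.\<close>
    have "coeff True (e + int t - int h) \<sigma> (interleave \<sigma> rs' ss) ts' = 0"
      if "prev" "h \<le> t"
      using Cons.prems True rs ts that by (intro Cons.IH) auto
    then show ?thesis
      using Cons.prems True rs ts by (cases prev) (auto simp: binom_def)
  next
    case False
    then obtain h ss' where ss: "ss = h # ss'" using Cons.prems by (cases ss) auto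
    have "coeff False (e + int t - int h) \<sigma> (interleave \<sigma> rs ss') ts' = 0"
      if "\<not> prev" "h \<le> t"
      using Cons.prems False ss ts that by (intro Cons.IH) auto
    then show ?thesis
      using Cons.prems False ss ts by (cases prev) (auto simp: binom_def)
  qed
qed

text \<open>Without a change of factor all binomials have lower entry \<open>h - 1\<close>, so a
  nonzero product would need \<open>h \<le> t\<close> throughout, against the sums. This handles the
  end of the word, where only one factor is left.\<close>

lemma coeff_deficient:
  assumes "set \<sigma> \<subseteq> {prev}" "length hs = length \<sigma>" "length ts = length \<sigma>" "sum_list ts < sum_list hs"
  shows "coeff prev e \<sigma> hs ts = 0"
  using assms
proof (induction \<sigma> arbitrary: e hs ts)
  case (Cons x \<sigma>)
  obtain t ts' h hs' where ts: "ts = t # ts'" and hs: "hs = h # hs'"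
    using Cons.prems by (cases ts; cases hs) auto
  have "coeff prev (e + int t - int h) \<sigma> hs' ts' = 0" if "h \<le> t"
    using Cons.prems ts hs that by (intro Cons.IH) auto
  then show ?case
    using Cons.prems ts hs by (auto simp: binom_def)
qed simp

lemma pattern_True: "\<sigma> \<in> patterns k 0 \<Longrightarrow> set \<sigma> \<subseteq> {True}"
  by (auto simp: patterns_def filter_empty_conv)

lemma pattern_False: "\<sigma> \<in> patterns 0 l \<Longrightarrow> set \<sigma> \<subseteq> {False}"
  by (auto simp: patterns_def filter_empty_conv)

lemma interleave_Nil2: "\<sigma> \<in> patterns (length rs) 0 \<Longrightarrow> interleave \<sigma> rs [] = rs"
  by (induction \<sigma> rs "[] :: 'a list" rule: interleave.induct) (auto split: if_splits)

lemma interleave_Nil1: "\<sigma> \<in> patterns 0 (length ss) \<Longrightarrow> interleave \<sigma> [] ss = ss"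
  by (induction \<sigma> "[] :: 'a list" ss rule: interleave.induct) (auto split: if_splits)

lemma binom_eq_choose:
  "1 \<le> t \<Longrightarrow> 1 \<le> m \<Longrightarrow> binom (int t - 1) (int m - 1) = int (t - 1 choose (m - 1))"
  by (auto simp: binom_def nat_diff_distrib' binomial_eq_0)

text \<open>Symmetry of the binomial coefficients: at a change of factor it turns the lower entry of
  $c(i)$ into the number of letters \<open>X0\<close> left in the completed block.\<close>

lemma binom_eq_choose_compl:
  assumes "1 \<le> t" "1 \<le> m"
  shows "binom (int t - 1) (int t - int m) = int (t - 1 choose (m - 1))"
proof (cases "m \<le> t")
  case True
  then have "nat (int t - int m) = (t - 1) - (m - 1)" "nat (int t - 1) = t - 1"
    using assms by auto
  then show ?thesis using True assms binomial_symmetric[of "m - 1" "t - 1"]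
    by (simp add: binom_def)
next
  case False
  then show ?thesis using assms by (auto simp: binom_def binomial_eq_0)
qed

text \<open>\<open>d\<close> and \<open>e\<close> count the letters already used from the current
  blocks of \<open>rs\<close> and \<open>ss\<close>. The factor that completed the last block starts
  a fresh one, so its count is 0 and \<open>d + e\<close> is the running excess of
  \<open>coeff\<close>. As long as no block is overdrawn, both recursions multiply by the same
  binomial; otherwise both sides are 0.\<close>

lemma coeff_eq_shuffle_mult:
  assumes "\<sigma> \<in> patterns (length rs) (length ss)" "length ts = length \<sigma>" "\<forall>t\<in>set ts. 1 \<le> t"
    and "\<forall>h\<in>set rs \<union> set ss. 1 \<le> h"
    and "sum_list ts + d + e = sum_list rs + sum_list ss"
    and "if prev then d = 0 else e = 0"
    and "if rs = [] then d = 0 else d < hd rs" and "if ss = [] then e = 0 else e < hd ss"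
  shows "coeff prev (int (d + e)) \<sigma> (interleave \<sigma> rs ss) ts = shuffle_mult \<sigma> ts (shorten d rs) (shorten e ss)"
  using assms
proof (induction \<sigma> arbitrary: prev d e rs ss ts)
  case Nil
  then show ?case by simp
next
  case (Cons x \<sigma>)
  obtain t ts' where ts: "ts = t # ts'" using Cons.prems by (cases ts) auto
  have t: "1 \<le> t" using Cons.prems ts by auto
  show ?case
  proof (cases x)
    case True
    then obtain h rs' where rs: "rs = h # rs'" using Cons.prems by (cases rs) auto
    have d: "d < h" using Cons.prems rs by simp
    \<comment> \<open>The completed block has \<open>h - 1 - d\<close> letters \<open>X0\<close>
      left. If \<open>prev\<close> holds then \<open>d = 0\<close>; if not, then
      \<open>e = 0\<close> and the symmetry applies with \<open>m = h - d\<close>.\<close>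
    have f: "(if True = prev then binom (int t - 1) (int h - 1)
        else binom (int t - 1) (int (d + e) + int t - int h)) = int (t - 1 choose (h - 1 - d))"
      using binom_eq_choose[of t h] binom_eq_choose_compl[of t "h - d"] t d Cons.prems
      by (cases prev) (auto simp: of_nat_diff algebra_simps)
    \<comment> \<open>A new block of length \<open>t\<close> takes \<open>h - d\<close> letters from
      the first factor and the other \<open>t - (h - d)\<close> from the second, which already had
      \<open>e\<close> used.\<close>
    define e' where "e' = d + e + t - h"
    have e': "int (d + e) + int t - int h = int e'" if "h - d \<le> t"
      using that d by (simp add: e'_def)
    define c where "c = coeff True (int (d + e) + int t - int h) \<sigma> (interleave \<sigma> rs' ss) ts'"
    have lhs: "coeff prev (int (d + e)) (x # \<sigma>) (interleave (x # \<sigma>) rs ss) ts =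
      int (t - 1 choose (h - 1 - d)) * c"
      by (simp only: True rs ts c_def interleave.simps coeff.simps f)
    \<comment> \<open>The first factor now starts a fresh block, so the induction hypothesis is used
      with \<open>d = 0\<close>.\<close>
    have good: "c = shuffle_mult \<sigma> ts' (shorten 0 rs') (shorten e' ss)"
      if "h - d \<le> t" "if ss = [] then e' = 0 else e' < hd ss"
    proof -
      have "coeff True (int (0 + e')) \<sigma> (interleave \<sigma> rs' ss) ts' =
        shuffle_mult \<sigma> ts' (shorten 0 rs') (shorten e' ss)"
        by (rule Cons.IH) (use Cons.prems True rs ts that in \<open>auto simp: e'_def neq_Nil_conv\<close>)
      then show ?thesis using e'[OF that(1)] by (simp add: c_def)
    qed
    show ?thesis
    proof (cases "h - d \<le> t")
      case False
      then have "t - 1 < h - 1 - d" using t by auto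
      then show ?thesis
        unfolding lhs using False by (cases ss) (auto simp: True rs ts binomial_eq_0)
    next
      case le: True
      show ?thesis
      proof (cases ss)
        case Nil
        \<comment> \<open>With the second factor exhausted, any excess \<open>e'\<close> is missing
          from the sum of the remaining block lengths.\<close>
        have "c = 0" if "e' \<noteq> 0"
          unfolding c_def
        proof (rule coeff_deficient)
          show "set \<sigma> \<subseteq> {True}" using Cons.prems Nil True rs by (intro pattern_True) auto
          have *: "\<sigma> \<in> patterns (length rs') 0" using Cons.prems Nil True rs by auto
          then show "length (interleave \<sigma> rs' ss) = length \<sigma>"
            using length_pattern[OF *] Nil by (simp add: interleave_Nil2)
          show "length ts' = length \<sigma>" using Cons.prems ts by auto
          show "sum_list ts' < sum_list (interleave \<sigma> rs' ss)"
            using Cons.prems that * Nil rs ts by (auto simp: interleave_Nil2 e'_def)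
        qed
        moreover have "t = Suc (h - 1 - d) \<longleftrightarrow> e' = 0"
          using Cons.prems Nil le d t by (auto simp: e'_def)
        ultimately show ?thesis
          unfolding lhs using good[OF le] Nil by (auto simp: True rs ts)
      next
        case (Cons g ss')
        \<comment> \<open>The final letter of the current block of \<open>ss\<close>, of length
          \<open>g\<close>, is still to come, so at most \<open>g - 1\<close> of its letters may be
          used.\<close>
        have "c = 0" if "\<not> e' < g"
          unfolding c_def e'[OF le]
          by (rule coeff_overdrawn) (use Cons.prems True rs ts Cons that in auto)
        moreover have "t \<le> Suc (h - 1 - d + (g - 1 - e)) \<longleftrightarrow> e' < g"
          using Cons.prems Cons le d t by (auto simp: e'_def)
        moreover have "h - 1 - d + (g - 1 - e) + 1 - t = g - 1 - e'" if "e' < g"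
          using Cons.prems Cons le d t that by (auto simp: e'_def)
        moreover have "Suc (h - 1 - d) \<le> t" using le d by auto
        ultimately show ?thesis
          unfolding lhs using good[OF le] Cons by (cases "e' < g") (auto simp: True rs ts)
      qed
    qed
  next
    \<comment> \<open>The mirror image: the second factor completes the block, and \<open>d\<close>
      and \<open>e\<close> exchange roles.\<close>
    case x: False
    then obtain h ss' where ss: "ss = h # ss'" using Cons.prems by (cases ss) auto
    have e: "e < h" using Cons.prems ss by simp
    have f: "(if False = prev then binom (int t - 1) (int h - 1)
        else binom (int t - 1) (int (d + e) + int t - int h)) = int (t - 1 choose (h - 1 - e))"
      using binom_eq_choose[of t h] binom_eq_choose_compl[of t "h - e"] t e Cons.prems
      by (cases prev) (auto simp: of_nat_diff algebra_simps)
    define d' where "d' = d + e + t - h"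
    have d': "int (d + e) + int t - int h = int d'" if "h - e \<le> t"
      using that e by (simp add: d'_def)
    define c where "c = coeff False (int (d + e) + int t - int h) \<sigma> (interleave \<sigma> rs ss') ts'"
    have lhs: "coeff prev (int (d + e)) (x # \<sigma>) (interleave (x # \<sigma>) rs ss) ts =
      int (t - 1 choose (h - 1 - e)) * c"
      by (simp only: x ss ts c_def interleave.simps coeff.simps f)
    have good: "c = shuffle_mult \<sigma> ts' (shorten d' rs) (shorten 0 ss')"
      if "h - e \<le> t" "if rs = [] then d' = 0 else d' < hd rs"
    proof -
      have "coeff False (int (d' + 0)) \<sigma> (interleave \<sigma> rs ss') ts' =
        shuffle_mult \<sigma> ts' (shorten d' rs) (shorten 0 ss')"
        by (rule Cons.IH) (use Cons.prems x ss ts that in \<open>auto simp: d'_def neq_Nil_conv\<close>)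
      then show ?thesis using d'[OF that(1)] by (simp add: c_def)
    qed
    show ?thesis
    proof (cases "h - e \<le> t")
      case False
      then have "t - 1 < h - 1 - e" using t by auto
      then show ?thesis
        unfolding lhs using False by (cases rs) (auto simp: x ss ts binomial_eq_0)
    next
      case le: True
      show ?thesis
      proof (cases rs)
        case Nil
        have "c = 0" if "d' \<noteq> 0"
          unfolding c_def
        proof (rule coeff_deficient)
          show "set \<sigma> \<subseteq> {False}" using Cons.prems Nil x ss by (intro pattern_False) auto
          have *: "\<sigma> \<in> patterns 0 (length ss')" using Cons.prems Nil x ss by auto
          then show "length (interleave \<sigma> rs ss') = length \<sigma>"
            using length_pattern[OF *] Nil by (simp add: interleave_Nil1)
          show "length ts' = length \<sigma>" using Cons.prems ts by auto
          show "sum_list ts' < sum_list (interleave \<sigma> rs ss')"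
            using Cons.prems that * Nil ss ts by (auto simp: interleave_Nil1 d'_def)
        qed
        moreover have "t = Suc (h - 1 - e) \<longleftrightarrow> d' = 0"
          using Cons.prems Nil le e t by (auto simp: d'_def)
        ultimately show ?thesis
          unfolding lhs using good[OF le] Nil by (auto simp: x ss ts)
      next
        case (Cons g rs')
        have "c = 0" if "\<not> d' < g"
          unfolding c_def d'[OF le]
          by (rule coeff_overdrawn) (use Cons.prems x ss ts Cons that in auto)
        moreover have "t \<le> Suc (h - 1 - e + (g - 1 - d)) \<longleftrightarrow> d' < g"
          using Cons.prems Cons le e t by (auto simp: d'_def)
        moreover have "h - 1 - e + (g - 1 - d) + 1 - t = g - 1 - d'" if "d' < g"
          using Cons.prems Cons le e t that by (auto simp: d'_def)
        moreover have "Suc (h - 1 - e) \<le> t" using le e by auto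
        ultimately show ?thesis
          unfolding lhs using good[OF le] Cons by (cases "d' < g") (auto simp: x ss ts)
      qed
    qed
  qed
qed

section \<open>Patterns and pairs of order-preserving injections\<close>

lemma length_interleave:
  "\<sigma> \<in> patterns (length xs) (length ys) \<Longrightarrow> length (interleave \<sigma> xs ys) = length \<sigma>"
  by (induction \<sigma> xs ys rule: interleave.induct) (auto simp: patterns_0_0 split: if_splits)

lemma nth_interleave:
  assumes "\<sigma> \<in> patterns (length xs) (length ys)" "i < length \<sigma>"
  shows "interleave \<sigma> xs ys ! i =
    (if \<sigma> ! i then xs ! length (filter (\<lambda>x. x) (take i \<sigma>)) else ys ! length (filter Not (take i \<sigma>)))"
  using assms
proof (induction \<sigma> xs ys arbitrary: i rule: interleave.induct)
  case (1 \<sigma> x xs ys)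
  then show ?case by (cases i) auto
next
  case (2 \<sigma> xs y ys)
  then show ?case by (cases i) auto
qed (auto simp: patterns_0_0 split: if_splits)

text \<open>By monotonicity and injectivity the elements of the image up to \<open>\<phi> j\<close>
  are exactly the values at \<open>1..j\<close>. Thus \<phi> enumerates its image in increasing
  order and is determined by it.\<close>

lemma rank_image:
  fixes \<phi> :: "nat \<Rightarrow> nat"
  assumes "\<phi> \<in> {1..k} \<rightarrow>\<^sub>E {1..n}" "mono_on {1..k} \<phi>" "inj_on \<phi> {1..k}" "j \<in> {1..k}"
  shows "card (\<phi> ` {1..k} \<inter> {1..\<phi> j}) = j"
proof -
  have le: "j' \<le> j" if "j' \<in> {1..k}" "\<phi> j' \<le> \<phi> j" for j'
  proof (rule ccontr)
    assume "\<not> j' \<le> j"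
    then have "\<phi> j \<le> \<phi> j'"
      using assms(4) that(1) by (intro mono_onD[OF assms(2)]) simp_all
    with that have "\<phi> j = \<phi> j'" by simp
    with assms that \<open>\<not> j' \<le> j\<close> show False by (auto dest: inj_onD)
  qed
  have "\<phi> ` {1..k} \<inter> {1..\<phi> j} = \<phi> ` {1..j}"
  proof (intro equalityI subsetI)
    fix i assume "i \<in> \<phi> ` {1..k} \<inter> {1..\<phi> j}"
    then show "i \<in> \<phi> ` {1..j}" using le by fastforce
  next
    fix i assume "i \<in> \<phi> ` {1..j}"
    then obtain j' where j': "i = \<phi> j'" "j' \<in> {1..j}" by auto
    then have "j' \<in> {1..k}" using assms(4) by auto
    then have "\<phi> j' \<in> {1..n}" "\<phi> j' \<le> \<phi> j"
      using assms j' by (auto intro: mono_onD[of "{1..k}"])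
    then show "i \<in> \<phi> ` {1..k} \<inter> {1..\<phi> j}" using j' \<open>j' \<in> {1..k}\<close> by auto
  qed
  moreover have "inj_on \<phi> {1..j}"
    using assms by (auto intro: inj_on_subset)
  ultimately show ?thesis by (simp add: card_image)
qed

text \<open>Expresses preimages by counting, which can be compared with the entries of a prefix of a
  pattern.\<close>

lemma rank_inv_into:
  fixes \<phi> :: "nat \<Rightarrow> nat"
  assumes "\<phi> \<in> {1..k} \<rightarrow>\<^sub>E {1..n}" "mono_on {1..k} \<phi>" "inj_on \<phi> {1..k}" "i \<in> \<phi> ` {1..k}"
  shows "inv_into {1..k} \<phi> i = card (\<phi> ` {1..k} \<inter> {1..i})"
  using rank_image[OF assms(1-3) inv_into_into[OF assms(4)]] assms(4)
  by (simp add: f_inv_into_f)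

lemma enumeration_exists:
  assumes "A \<subseteq> {1..n::nat}" "card A = k"
  obtains \<phi> where "\<phi> \<in> {1..k} \<rightarrow>\<^sub>E {1..n}" "mono_on {1..k} \<phi>" "inj_on \<phi> {1..k}" "\<phi> ` {1..k} = A"
proof
  define xs where "xs = sorted_list_of_set A"
  have fin: "finite A" using assms finite_subset by blast
  have xs: "sorted xs" "distinct xs" "set xs = A" "length xs = k"
    using fin assms by (auto simp: xs_def)
  \<comment> \<open>The shift by one adapts list positions, which start at 0; the restriction gives
    the extensional function required by \<open>\<rightarrow>\<^sub>E\<close>.\<close>
  define \<phi> where "\<phi> = restrict (\<lambda>j. xs ! (j - 1)) {1..k}"
  have "\<phi> ` {1..k} = (\<lambda>j. xs ! (j - 1)) ` Suc ` {..<k}"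
    unfolding image_Suc_lessThan by (simp add: \<phi>_def)
  also have "(\<lambda>j. xs ! (j - 1)) ` Suc ` {..<k} = A"
    using xs by (auto simp: image_image set_conv_nth)
  finally show im: "\<phi> ` {1..k} = A" .
  show "mono_on {1..k} \<phi>"
    using xs by (auto simp: \<phi>_def mono_on_def intro: sorted_nth_mono)
  show "inj_on \<phi> {1..k}"
    using xs by (auto simp: \<phi>_def inj_on_def nth_eq_iff_index_eq)
  show "\<phi> \<in> {1..k} \<rightarrow>\<^sub>E {1..n}"
    using im assms by (intro PiE_I) (blast, auto simp: \<phi>_def)
qed

lemma enumeration_unique:
  fixes \<phi> \<phi>' :: "nat \<Rightarrow> nat"
  assumes "\<phi> \<in> {1..k} \<rightarrow>\<^sub>E {1..n}" "mono_on {1..k} \<phi>" "inj_on \<phi> {1..k}"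
    and "\<phi>' \<in> {1..k} \<rightarrow>\<^sub>E {1..n}" "mono_on {1..k} \<phi>'" "inj_on \<phi>' {1..k}"
    and "\<phi> ` {1..k} = \<phi>' ` {1..k}"
  shows "\<phi> = \<phi>'"
proof (rule PiE_ext[OF assms(1,4)])
  fix j assume j: "j \<in> {1..k}"
  with assms(7) obtain j' where j': "j' \<in> {1..k}" "\<phi> j = \<phi>' j'" by blast
  then have "j = j'"
    using rank_image[OF assms(1-3) j] rank_image[OF assms(4-6) j'(1)] assms(7) by simp
  with j' show "\<phi> j = \<phi>' j" by simp
qed

text \<open>\<psi> does not enter, since it is the increasing enumeration of the complement of the
  image of \<phi>.\<close>

definition pattern_of :: "nat \<Rightarrow> nat \<Rightarrow> (nat \<Rightarrow> nat) \<Rightarrow> bool list" where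
  "pattern_of k l \<phi> = map (\<lambda>i. i \<in> \<phi> ` {1..k}) [1..<Suc (k + l)]"

lemma length_filter_map_upt:
  "length (filter P (map f [1..<Suc n])) = card {i \<in> {1..n}. P (f i)}"
  by (simp add: filter_map distinct_length_filter comp_def del: upt_Suc)
     (rule arg_cong[of _ _ card], auto)

lemma I_pairsD:
  assumes "(\<phi>, \<psi>) \<in> I_pairs k l"
  shows "\<phi> \<in> {1..k} \<rightarrow>\<^sub>E {1..k+l}" "mono_on {1..k} \<phi>" "inj_on \<phi> {1..k}"
    and "\<psi> \<in> {1..l} \<rightarrow>\<^sub>E {1..k+l}" "mono_on {1..l} \<psi>" "inj_on \<psi> {1..l}"
    and "\<phi> ` {1..k} \<subseteq> {1..k+l}" "\<psi> ` {1..l} = {1..k+l} - \<phi> ` {1..k}"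
proof -
  have "\<phi> ` {1..k} \<inter> \<psi> ` {1..l} = {}" "\<phi> ` {1..k} \<union> \<psi> ` {1..l} = {1..k+l}"
    using assms by (simp_all add: I_pairs_def)
  then show "\<phi> ` {1..k} \<subseteq> {1..k+l}" "\<psi> ` {1..l} = {1..k+l} - \<phi> ` {1..k}"
    by (metis Un_upper1, metis Un_Diff_cancel2 Diff_triv Un_Diff Int_commute Diff_cancel sup_bot_left)
qed (use assms in \<open>simp_all add: I_pairs_def\<close>)

text \<open>The pattern determines the image of \<phi>, its complement is the image of \<psi>, and
  each is enumerated by exactly one order-preserving injection. Conversely, the positions of
  \<open>True\<close> and of \<open>False\<close> can be so enumerated.\<close>

lemma bij_betw_pattern_of:
  "bij_betw (\<lambda>(\<phi>, \<psi>). pattern_of k l \<phi>) (I_pairs k l) (patterns k l)"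
  unfolding bij_betw_def
proof (intro conjI equalityI)
  show "inj_on (\<lambda>(\<phi>, \<psi>). pattern_of k l \<phi>) (I_pairs k l)"
  proof (rule inj_onI, clarify)
    fix \<phi> \<psi> \<phi>' \<psi>'
    assume *: "(\<phi>, \<psi>) \<in> I_pairs k l" "(\<phi>', \<psi>') \<in> I_pairs k l"
      and eq: "pattern_of k l \<phi> = pattern_of k l \<phi>'"
    note I = I_pairsD[OF *(1)] and I' = I_pairsD[OF *(2)]
    have mem: "i \<in> \<phi> ` {1..k} \<longleftrightarrow> i \<in> \<phi>' ` {1..k}" if "i \<in> {1..k+l}" for i
      using eq that unfolding pattern_of_def map_eq_conv by (auto simp del: upt_Suc)
    have A: "\<phi> ` {1..k} = \<phi>' ` {1..k}"
      using mem I(7) I'(7) by (intro Set.set_eqI) (meson subsetD)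
    have "\<phi> = \<phi>'" by (rule enumeration_unique[OF I(1-3) I'(1-3) A])
    moreover have "\<psi> = \<psi>'" by (rule enumeration_unique[OF I(4-6) I'(4-6)]) (simp only: I(8) I'(8) A)
    ultimately show "\<phi> = \<phi>' \<and> \<psi> = \<psi>'" by simp
  qed
  show "(\<lambda>(\<phi>, \<psi>). pattern_of k l \<phi>) ` I_pairs k l \<subseteq> patterns k l"
  proof clarify
    fix \<phi> \<psi> assume *: "(\<phi>, \<psi>) \<in> I_pairs k l"
    note I = I_pairsD[OF *]
    have "{i \<in> {1..k+l}. i \<in> \<phi> ` {1..k}} = \<phi> ` {1..k}"
      "{i \<in> {1..k+l}. i \<notin> \<phi> ` {1..k}} = \<psi> ` {1..l}"
      unfolding I(8) using I(7) by blast+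
    moreover have "card (\<phi> ` {1..k}) = k" "card (\<psi> ` {1..l}) = l"
      using I(3,6) by (simp_all add: card_image)
    ultimately show "pattern_of k l \<phi> \<in> patterns k l"
      unfolding patterns_def pattern_of_def mem_Collect_eq length_filter_map_upt by simp
  qed
  show "patterns k l \<subseteq> (\<lambda>(\<phi>, \<psi>). pattern_of k l \<phi>) ` I_pairs k l"
  proof
    fix \<sigma> assume \<sigma>: "\<sigma> \<in> patterns k l"
    define A where "A = {i \<in> {1..k+l}. \<sigma> ! (i - 1)}"
    define B where "B = {i \<in> {1..k+l}. \<not> \<sigma> ! (i - 1)}"
    have eq: "\<sigma> = map (\<lambda>i. \<sigma> ! (i - 1)) [1..<Suc (k+l)]"
      using length_pattern[OF \<sigma>] by (intro nth_equalityI) (auto simp del: upt_Suc)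
    have "length (filter (\<lambda>x. x) \<sigma>) = card A" "length (filter Not \<sigma>) = card B"
      unfolding A_def B_def by (subst eq, subst length_filter_map_upt, simp)+
    then have card: "card A = k" "card B = l" using \<sigma> by (auto simp: patterns_def)
    have sub: "A \<subseteq> {1..k+l}" "B \<subseteq> {1..k+l}" by (auto simp: A_def B_def)
    obtain \<phi> where \<phi>: "\<phi> \<in> {1..k} \<rightarrow>\<^sub>E {1..k+l}" "mono_on {1..k} \<phi>" "inj_on \<phi> {1..k}" "\<phi> ` {1..k} = A"
      using enumeration_exists[OF sub(1) card(1)] .
    obtain \<psi> where \<psi>: "\<psi> \<in> {1..l} \<rightarrow>\<^sub>E {1..k+l}" "mono_on {1..l} \<psi>" "inj_on \<psi> {1..l}" "\<psi> ` {1..l} = B"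
      using enumeration_exists[OF sub(2) card(2)] .
    have "(\<phi>, \<psi>) \<in> I_pairs k l"
      using \<phi> \<psi> by (simp add: I_pairs_def) (auto simp: A_def B_def)
    moreover have "\<sigma> = pattern_of k l \<phi>"
      unfolding pattern_of_def \<phi>(4) by (subst eq) (auto simp: A_def simp del: upt_Suc)
    ultimately show "\<sigma> \<in> (\<lambda>(\<phi>, \<psi>). pattern_of k l \<phi>) ` I_pairs k l" by force
  qed
qed

lemma pattern_of_in_patterns: "(\<phi>, \<psi>) \<in> I_pairs k l \<Longrightarrow> pattern_of k l \<phi> \<in> patterns k l"
  using bij_betw_pattern_of[of k l] by (auto simp: bij_betw_def)

section \<open>Vectors on index ranges and their list forms\<close>

lemma sum_list_map_upt_Suc: "sum_list (map f [1..<Suc n]) = sum f {1..n}"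
  for f :: "nat \<Rightarrow> nat"
  by (simp add: interv_sum_list_conv_sum_set_nat atLeastLessThanSuc_atLeastAtMost del: upt_Suc)

lemma bij_betw_T_vecs:
  "bij_betw (\<lambda>t. map t [1..<Suc (k+l)]) (T_vecs k l r s)
     (comps (k + l) (sum r {1..k} + sum s {1..l}))"
  unfolding bij_betw_def
proof (intro conjI equalityI)
  show "inj_on (\<lambda>t. map t [1..<Suc (k+l)]) (T_vecs k l r s)"
  proof (rule inj_onI)
    fix t t' assume *: "t \<in> T_vecs k l r s" "t' \<in> T_vecs k l r s"
      "map t [1..<Suc (k+l)] = map t' [1..<Suc (k+l)]"
    have "t \<in> {1..k+l} \<rightarrow>\<^sub>E {1..}" "t' \<in> {1..k+l} \<rightarrow>\<^sub>E {1..}" using * by (auto simp: T_vecs_def)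
    then show "t = t'" by (rule PiE_ext) (use *(3) in \<open>auto simp del: upt_Suc\<close>)
  qed
  show "(\<lambda>t. map t [1..<Suc (k+l)]) ` T_vecs k l r s \<subseteq> comps (k + l) (sum r {1..k} + sum s {1..l})"
  proof clarify
    fix t assume t: "t \<in> T_vecs k l r s"
    have "1 \<le> t i" if "i \<in> {1..k+l}" for i
      using t that by (auto simp: T_vecs_def)
    then show "map t [1..<Suc (k+l)] \<in> comps (k + l) (sum r {1..k} + sum s {1..l})"
      using t unfolding comps_def mem_Collect_eq sum_list_map_upt_Suc by (simp add: T_vecs_def del: upt_Suc)
  qed
  show "comps (k + l) (sum r {1..k} + sum s {1..l}) \<subseteq> (\<lambda>t. map t [1..<Suc (k+l)]) ` T_vecs k l r s"
  proof
    fix ts assume ts: "ts \<in> comps (k + l) (sum r {1..k} + sum s {1..l})"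
    define t where "t = restrict (\<lambda>i. ts ! (i - 1)) {1..k+l}"
    have eq: "ts = map t [1..<Suc (k+l)]"
      using ts by (intro nth_equalityI) (auto simp: comps_def t_def simp del: upt_Suc)
    have "t i \<in> {1..}" if "i \<in> {1..k+l}" for i
      using ts that by (auto simp: t_def comps_def)
    then have "t \<in> T_vecs k l r s"
      using ts sum_list_map_upt_Suc[of t "k + l"] unfolding T_vecs_def eq[symmetric]
      by (auto simp: comps_def t_def)
    with eq show "ts \<in> (\<lambda>t. map t [1..<Suc (k+l)]) ` T_vecs k l r s" by blast
  qed
qed

text \<open>For \<open>r\<close> and \<open>s\<close> this is the vector $h$; the general entry type
  lets it also merge the group elements that index the letters.\<close>

definition merge_vec ::
  "nat \<Rightarrow> nat \<Rightarrow> (nat \<Rightarrow> nat) \<Rightarrow> (nat \<Rightarrow> nat) \<Rightarrow> (nat \<Rightarrow> 'a) \<Rightarrow> (nat \<Rightarrow> 'a) \<Rightarrow> nat \<Rightarrow> 'a" where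
  "merge_vec k l \<phi> \<psi> f g i =
     (if i \<in> \<phi> ` {1..k} then f (inv_into {1..k} \<phi> i) else g (inv_into {1..l} \<psi> i))"

text \<open>The preimage of a position is one more than the number of earlier positions in the same
  image, and \<open>nth_interleave\<close> selects entries by just this number.\<close>

lemma interleave_pattern_of:
  assumes I: "(\<phi>, \<psi>) \<in> I_pairs k l"
  shows "interleave (pattern_of k l \<phi>) (map f [1..<Suc k]) (map g [1..<Suc l]) =
    map (merge_vec k l \<phi> \<psi> f g) [1..<Suc (k + l)]" (is "?L = _")
proof (rule nth_equalityI)
  have pat: "pattern_of k l \<phi> \<in> patterns (length (map f [1..<Suc k])) (length (map g [1..<Suc l]))"
    using pattern_of_in_patterns[OF I] by (simp del: upt_Suc)
  have len: "length (pattern_of k l \<phi>) = k + l" by (simp add: pattern_of_def del: upt_Suc)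
  show "length ?L = length (map (merge_vec k l \<phi> \<psi> f g) [1..<Suc (k + l)])"
    using length_interleave[OF pat] len by (simp del: upt_Suc)
  fix i assume "i < length ?L"
  then have i: "i < k + l" using length_interleave[OF pat] len by simp
  have tk: "take i (pattern_of k l \<phi>) = map (\<lambda>i. i \<in> \<phi> ` {1..k}) [1..<Suc i]"
    using i by (simp add: pattern_of_def take_map del: upt_Suc)
  have step: "card (A \<inter> {1..Suc i}) = Suc (card {j \<in> {1..i}. j \<in> A})" if "Suc i \<in> A" for A
  proof -
    have "A \<inter> {1..Suc i} = insert (Suc i) {j \<in> {1..i}. j \<in> A}" using that by auto
    then show ?thesis by simp
  qed
  show "?L ! i = map (merge_vec k l \<phi> \<psi> f g) [1..<Suc (k + l)] ! i"
  proof (cases "Suc i \<in> \<phi> ` {1..k}")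
    case True
    have "inv_into {1..k} \<phi> (Suc i) = Suc (card {j \<in> {1..i}. j \<in> \<phi> ` {1..k}})"
      using rank_inv_into[of \<phi> k "k + l" "Suc i"] I_pairsD[OF I] True step[OF True] by simp
    moreover have "inv_into {1..k} \<phi> (Suc i) \<in> {1..k}" using True by (rule inv_into_into)
    ultimately show ?thesis
      unfolding nth_interleave[OF pat, unfolded len, OF i] tk length_filter_map_upt
      using True i by (simp add: merge_vec_def pattern_of_def del: upt_Suc)
  next
    case False
    then have mem: "Suc i \<in> \<psi> ` {1..l}" using I_pairsD(8)[OF I] i by auto
    have "{j \<in> {1..i}. j \<in> \<psi> ` {1..l}} = {j \<in> {1..i}. j \<notin> \<phi> ` {1..k}}"
      unfolding I_pairsD(8)[OF I] using i by (intro Collect_cong) auto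
    then have "inv_into {1..l} \<psi> (Suc i) = Suc (card {j \<in> {1..i}. j \<notin> \<phi> ` {1..k}})"
      using rank_inv_into[of \<psi> l "k + l" "Suc i"] I_pairsD[OF I] mem step[OF mem] by simp
    moreover have "inv_into {1..l} \<psi> (Suc i) \<in> {1..l}" using mem by (rule inv_into_into)
    ultimately show ?thesis
      unfolding nth_interleave[OF pat, unfolded len, OF i] tk length_filter_map_upt
      using False i by (simp add: merge_vec_def pattern_of_def del: upt_Suc)
  qed
qed

text \<open>An arbitrary start \<open>m\<close> makes the induction work: the state of
  \<open>coeff\<close> there consists of \<open>x (m - 1)\<close> and the difference of the partial
  sums below \<open>m\<close>.\<close>

lemma coeff_map:
  fixes h t :: "nat \<Rightarrow> nat"
  assumes "1 \<le> m"
  shows "coeff (x (m - 1)) ((\<Sum>j=1..<m. int (t j)) - (\<Sum>j=1..<m. int (h j)))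
      (map x [m..<m+d]) (map h [m..<m+d]) (map t [m..<m+d]) =
    (\<Prod>i=m..<m+d. if x i = x (i - 1) then binom (int (t i) - 1) (int (h i) - 1)
       else binom (int (t i) - 1) ((\<Sum>j=1..i. int (t j)) - (\<Sum>j=1..i. int (h j))))"
  using assms
proof (induction d arbitrary: m)
  case 0
  then show ?case by simp
next
  case (Suc d)
  have upt: "[m..<m + Suc d] = m # [Suc m..<Suc m + d]"
    using upt_conv_Cons[of m "m + Suc d"] by simp
  have set: "{m..<m + Suc d} = insert m {Suc m..<Suc m + d}" by auto
  have sum: "(\<Sum>j=1..<Suc m. f j) = (\<Sum>j=1..<m. f j) + f m" "(\<Sum>j=1..m. f j) = (\<Sum>j=1..<m. f j) + f m"
    for f :: "nat \<Rightarrow> int"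
    using Suc.prems by (simp_all add: sum.last_plus sum.atLeastLessThan_Suc add.commute)
  have e: "(\<Sum>j=1..<m. int (t j)) - (\<Sum>j=1..<m. int (h j)) + int (t m) - int (h m) =
    (\<Sum>j=1..<Suc m. int (t j)) - (\<Sum>j=1..<Suc m. int (h j))"
    "(\<Sum>j=1..m. int (t j)) - (\<Sum>j=1..m. int (h j)) =
    (\<Sum>j=1..<Suc m. int (t j)) - (\<Sum>j=1..<Suc m. int (h j))"
    unfolding sum by simp_all
  define F where "F i = (if x i = x (i - 1) then binom (int (t i) - 1) (int (h i) - 1)
       else binom (int (t i) - 1) ((\<Sum>j=1..i. int (t j)) - (\<Sum>j=1..i. int (h j))))" for i
  have IH: "coeff (x m) ((\<Sum>j=1..<Suc m. int (t j)) - (\<Sum>j=1..<Suc m. int (h j)))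
      (map x [Suc m..<Suc m+d]) (map h [Suc m..<Suc m+d]) (map t [Suc m..<Suc m+d]) =
    (\<Prod>i=Suc m..<Suc m+d. F i)"
    unfolding F_def using Suc.IH[of "Suc m"] by (simp only: diff_Suc_1)
  have "(\<Prod>i=m..<m + Suc d. F i) = F m * (\<Prod>i=Suc m..<Suc m+d. F i)"
    unfolding set by (rule prod.insert) auto
  moreover have "F m = (if x m = x (m - 1) then binom (int (t m) - 1) (int (h m) - 1)
       else binom (int (t m) - 1) ((\<Sum>j=1..<Suc m. int (t j)) - (\<Sum>j=1..<Suc m. int (h j))))"
    unfolding F_def e ..
  ultimately show ?case
    unfolding upt list.map coeff.simps e(1) IH F_def[symmetric] by (simp only:)
qed

lemma c_coeff_eq_coeff:
  assumes "1 \<le> k + l"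
  shows "c_coeff k l r s t \<phi> \<psi> = coeff (1 \<in> \<phi> ` {1..k}) 0 (pattern_of k l \<phi>)
    (map (merge_vec k l \<phi> \<psi> r s) [1..<Suc (k + l)]) (map t [1..<Suc (k + l)])"
proof -
  \<comment> \<open>Index 0 repeats the value at 1, so the first position counts as no change of
    factor, as $c(1)$ requires.\<close>
  define x where "x i = (if i = 0 then 1 \<in> \<phi> ` {1..k} else i \<in> \<phi> ` {1..k})" for i
  have h: "h_entry k l r s \<phi> \<psi> = merge_vec k l \<phi> \<psi> r s"
    by (simp add: fun_eq_iff h_entry_def merge_vec_def)
  have pat: "pattern_of k l \<phi> = map x [1..<Suc (k + l)]"
    by (auto simp: pattern_of_def x_def simp del: upt_Suc)
  have "(i = 1 \<or> eps k \<phi> i = eps k \<phi> (i - 1)) \<longleftrightarrow> x i = x (i - 1)" if "i \<in> {1..k+l}" for i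
    using that by (auto simp: eps_def x_def)
  then have "c_coeff k l r s t \<phi> \<psi> =
    (\<Prod>i=1..<1+(k+l). if x i = x (i - 1) then binom (int (t i) - 1) (int (merge_vec k l \<phi> \<psi> r s i) - 1)
       else binom (int (t i) - 1)
         ((\<Sum>j=1..i. int (t j)) - (\<Sum>j=1..i. int (merge_vec k l \<phi> \<psi> r s j))))"
    unfolding c_coeff_def c_factor_def h
    by (intro prod.cong) (auto simp del: One_nat_def)
  also have "\<dots> = coeff (x (1 - 1)) ((\<Sum>j=1..<1. int (t j)) - (\<Sum>j=1..<1. int (merge_vec k l \<phi> \<psi> r s j)))
      (map x [1..<1+(k+l)]) (map (merge_vec k l \<phi> \<psi> r s) [1..<1+(k+l)]) (map t [1..<1+(k+l)])"
    by (rule coeff_map[symmetric]) simp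
  finally show ?thesis by (simp add: pat x_def del: upt_Suc)
qed

section \<open>Transport along \<open>eta\<close>\<close>

lemma basis_word_eq_blocks:
  "basis_word n s b = blocks (map (\<lambda>i. (s i - 1, b i)) [1..<Suc n])"
  by (simp add: basis_word_def blocks_def comp_def del: upt_Suc)

text \<open>The identity before \<open>eta\<close> is applied, with letters merged unchanged: the
  sum over patterns and compositions is reindexed by the two bijections, and the multiplicities
  become the coefficients $c$.\<close>

lemma shuffle_word_basis_word:
  fixes r s :: "nat \<Rightarrow> nat"
  assumes "1 \<le> k + l" and r: "\<And>i. i \<in> {1..k} \<Longrightarrow> 1 \<le> r i" and s: "\<And>i. i \<in> {1..l} \<Longrightarrow> 1 \<le> s i"
  shows "shuffle_word (basis_word k r b) (basis_word l s c) =
    (\<Sum>(\<phi>, \<psi>)\<in>I_pairs k l. \<Sum>t\<in>T_vecs k l r s. frag_cmul (c_coeff k l r s t \<phi> \<psi>)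
       (frag_of (basis_word (k + l) t (merge_vec k l \<phi> \<psi> b c))))"
proof -
  define us where "us = map (\<lambda>i. (r i - 1, b i)) [1..<Suc k]"
  define vs where "vs = map (\<lambda>i. (s i - 1, c i)) [1..<Suc l]"
  have len: "length us = k" "length vs = l"
    by (simp_all add: us_def vs_def del: upt_Suc)
  have "weight us = (\<Sum>i=1..k. Suc (r i - 1))" "weight vs = (\<Sum>i=1..l. Suc (s i - 1))"
    unfolding weight_def us_def vs_def sum_list_map_upt_Suc[symmetric] by (simp_all add: comp_def del: upt_Suc)
  moreover have "(\<Sum>i=1..k. Suc (r i - 1)) = sum r {1..k}" "(\<Sum>i=1..l. Suc (s i - 1)) = sum s {1..l}"
    by (intro sum.cong refl; use r s in force)+
  ultimately have weight: "weight us = sum r {1..k}" "weight vs = sum s {1..l}"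
    by simp_all
  have "shuffle_word (basis_word k r b) (basis_word l s c) = (\<Sum>\<sigma>\<in>patterns k l.
     \<Sum>ts\<in>comps (k + l) (sum r {1..k} + sum s {1..l}). pattern_term us vs \<sigma> ts)"
    unfolding basis_word_eq_blocks us_def[symmetric] vs_def[symmetric]
      shuffle_word_eq_pattern_sum pattern_sum_def len weight ..
  also have "\<dots> = (\<Sum>p\<in>I_pairs k l. \<Sum>t\<in>T_vecs k l r s.
     pattern_term us vs (case p of (\<phi>, \<psi>) \<Rightarrow> pattern_of k l \<phi>) (map t [1..<Suc (k + l)]))"
    unfolding sum.reindex_bij_betw[OF bij_betw_pattern_of, symmetric]
      sum.reindex_bij_betw[OF bij_betw_T_vecs, symmetric] ..
  also have "\<dots> = (\<Sum>(\<phi>, \<psi>)\<in>I_pairs k l. \<Sum>t\<in>T_vecs k l r s. frag_cmul (c_coeff k l r s t \<phi> \<psi>)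
       (frag_of (basis_word (k + l) t (merge_vec k l \<phi> \<psi> b c))))"
  proof (rule sum.cong[OF refl], clarify, rule sum.cong[OF refl])
    fix \<phi> \<psi> t assume I: "(\<phi>, \<psi>) \<in> I_pairs k l" and t: "t \<in> T_vecs k l r s"
    define ts where "ts = map t [1..<Suc (k + l)]"
    have ts: "ts \<in> comps (k + l) (sum r {1..k} + sum s {1..l})"
      unfolding ts_def using bij_betwE[OF bij_betw_T_vecs] t by blast
    have pat: "pattern_of k l \<phi> \<in> patterns k l" by (rule pattern_of_in_patterns[OF I])
    \<comment> \<open>Nothing is used up at the start, so \<open>d = e = 0\<close>, which is
      admissible for either value of \<open>prev\<close>.\<close>
    have "coeff (1 \<in> \<phi> ` {1..k}) (int (0 + 0)) (pattern_of k l \<phi>)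
        (interleave (pattern_of k l \<phi>) (map r [1..<Suc k]) (map s [1..<Suc l])) ts =
      shuffle_mult (pattern_of k l \<phi>) ts (shorten 0 (map r [1..<Suc k])) (shorten 0 (map s [1..<Suc l]))"
    proof (rule coeff_eq_shuffle_mult)
      show "pattern_of k l \<phi> \<in> patterns (length (map r [1..<Suc k])) (length (map s [1..<Suc l]))"
        using pat by (simp del: upt_Suc)
      show "length ts = length (pattern_of k l \<phi>)" by (simp add: ts_def pattern_of_def)
      show "\<forall>t\<in>set ts. 1 \<le> t" using ts by (auto simp: comps_def)
      show "\<forall>h\<in>set (map r [1..<Suc k]) \<union> set (map s [1..<Suc l]). 1 \<le> h"
        using r s by (auto simp del: upt_Suc)
      show "sum_list ts + 0 + 0 = sum_list (map r [1..<Suc k]) + sum_list (map s [1..<Suc l])"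
        unfolding sum_list_map_upt_Suc using ts by (simp add: comps_def)
      show "if map r [1..<Suc k] = [] then 0 = (0::nat) else 0 < hd (map r [1..<Suc k])"
        using r[of 1] by (auto simp: hd_map simp del: upt_Suc)
      show "if map s [1..<Suc l] = [] then 0 = (0::nat) else 0 < hd (map s [1..<Suc l])"
        using s[of 1] by (auto simp: hd_map simp del: upt_Suc)
    qed simp
    moreover have "map fst us = shorten 0 (map r [1..<Suc k])" "map fst vs = shorten 0 (map s [1..<Suc l])"
      by (simp_all add: us_def vs_def del: upt_Suc)
    ultimately have m: "shuffle_mult (pattern_of k l \<phi>) ts (map fst us) (map fst vs) = c_coeff k l r s t \<phi> \<psi>"
      unfolding interleave_pattern_of[OF I] c_coeff_eq_coeff[OF assms(1)] ts_def by simp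
    have snd: "map snd us = map b [1..<Suc k]" "map snd vs = map c [1..<Suc l]"
      by (simp_all add: us_def vs_def del: upt_Suc)
    have "zip (map (\<lambda>t. t - 1) ts) (map (merge_vec k l \<phi> \<psi> b c) [1..<Suc (k + l)]) =
      map (\<lambda>i. (t i - 1, merge_vec k l \<phi> \<psi> b c i)) [1..<Suc (k + l)]"
      by (simp add: ts_def zip_map_map zip_same_conv_map comp_def del: upt_Suc)
    then show "pattern_term us vs (pattern_of k l \<phi>) (map t [1..<Suc (k + l)]) =
      frag_cmul (c_coeff k l r s t \<phi> \<psi>)
       (frag_of (basis_word (k + l) t (merge_vec k l \<phi> \<psi> b c)))"
      unfolding ts_def[symmetric] pattern_term_def m snd interleave_pattern_of[OF I]
        basis_word_eq_blocks by (simp only:)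
  qed
  finally show ?thesis .
qed

section \<open>Prefix products and quotients of neighbouring letters\<close>

context comm_group
begin

definition prefix_inv :: "(nat \<Rightarrow> 'a) \<Rightarrow> nat \<Rightarrow> 'a" where
  "prefix_inv w j = inv (finprod G w {1..j})"

lemma finprod_prefix_closed:
  "w \<in> {1..k::nat} \<rightarrow> carrier G \<Longrightarrow> j \<le> k \<Longrightarrow> finprod G w {1..j} \<in> carrier G"
  by (rule finprod_closed) (auto simp: Pi_iff)

lemma inv_prefix_inv:
  "w \<in> {1..k} \<rightarrow> carrier G \<Longrightarrow> j \<le> k \<Longrightarrow> inv (prefix_inv w j) = finprod G w {1..j}"
  by (simp add: prefix_inv_def finprod_prefix_closed del: One_nat_def)

lemma prefix_inv_closed:
  "w \<in> {1..k} \<rightarrow> carrier G \<Longrightarrow> j \<le> k \<Longrightarrow> prefix_inv w j \<in> carrier G"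
  by (simp add: prefix_inv_def finprod_prefix_closed del: One_nat_def)

lemma prefix_inv_quotient:
  assumes "w \<in> {1..k} \<rightarrow> carrier G" "Suc j \<le> k"
  shows "prefix_inv w j \<otimes> inv (prefix_inv w (Suc j)) = w (Suc j)"
proof -
  have w: "w (Suc j) \<in> carrier G" using assms by auto
  have P: "finprod G w {1..j} \<in> carrier G" using assms by (intro finprod_prefix_closed) auto
  have "{1..Suc j} = insert (Suc j) {1..j}" by auto
  then have "finprod G w {1..Suc j} = w (Suc j) \<otimes> finprod G w {1..j}"
    using assms w by (simp, subst finprod_insert) auto
  with w P show ?thesis
    unfolding inv_prefix_inv[OF assms] by (simp add: prefix_inv_def m_lcomm[of "inv _"])
qed

lemma prefix_inv_0: "prefix_inv w 0 = \<one>"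
  by (simp add: prefix_inv_def)

text \<open>As \<open>eta\<close> is injective on \<open>H1 G\<close>, it suffices that the proposed
  word lies there and is mapped correctly; its quotients of neighbouring letters are the entries of
  \<open>w\<close>.\<close>

lemma inv_into_eta:
  assumes "\<And>i. i \<in> {1..n} \<Longrightarrow> 1 \<le> r i" and w: "w \<in> {1..n} \<rightarrow> carrier G"
  shows "inv_into (H1 G) (eta G) (frag_of (vec_word n r w)) = frag_of (basis_word n r (prefix_inv w))"
proof (rule inv_into_f_eq)
  show "inj_on (eta G) (H1 G)" using bij_betw_eta by (rule bij_betw_imp_inj_on)
  have "basis_word n r (prefix_inv w) \<in> lists (insert X0 (X ` carrier G))"
    using prefix_inv_closed[OF w] by (auto simp: basis_word_def simp del: upt_Suc)
  moreover have "basis_word n r (prefix_inv w) = [] \<or>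
      (\<exists>b\<in>carrier G. last (basis_word n r (prefix_inv w)) = X b)"
    using prefix_inv_closed[OF w, of n] by (cases n) (auto simp: basis_word_def)
  ultimately have "basis_word n r (prefix_inv w) \<in> words_H1 G" by (simp add: words_H1_def)
  then show "frag_of (basis_word n r (prefix_inv w)) \<in> H1 G" by (simp add: H1_def)
  have quot: "(if i = 1 then \<one> else prefix_inv w (i - 1)) \<otimes> inv (prefix_inv w i) = w i" if "i \<in> {1..n}" for i
    using prefix_inv_quotient[OF w, of "i - 1"] that by (cases "i = 1") (auto simp: prefix_inv_0)
  have "vec_word n r (\<lambda>i. (if i = 1 then \<one> else prefix_inv w (i - 1)) \<otimes> inv (prefix_inv w i)) =
      vec_word n r w"
    unfolding vec_word_def by (rule map_cong[OF refl]) (use quot in \<open>simp del: upt_Suc\<close>)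
  then show "eta G (frag_of (basis_word n r (prefix_inv w))) = frag_of (vec_word n r w)"
    using eta_word_basis_word[of n r G "prefix_inv w", OF assms(1)]
    by (simp add: eta_def del: One_nat_def)
qed

text \<open>Two neighbouring letters from the same factor have a telescoping quotient, a single
  entry of \<open>w\<close> or \<open>z\<close>. Letters from different factors give a quotient of a
  prefix product of \<open>w\<close> and one of \<open>z\<close>, whose lengths add up to
  \<open>i\<close>.\<close>

lemma bar_shuffle_eq_quotient:
  assumes I: "(\<phi>, \<psi>) \<in> I_pairs k l" and i: "i \<in> {1..k+l}"
    and w: "w \<in> {1..k} \<rightarrow> carrier G" and z: "z \<in> {1..l} \<rightarrow> carrier G"
  defines "x \<equiv> merge_vec k l \<phi> \<psi> (prefix_inv w) (prefix_inv z)"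
  shows "(if i = 1 then \<one> else x (i - 1)) \<otimes> inv (x i) = bar_shuffle G k l \<phi> \<psi> w z i"
proof -
  note D = I_pairsD[OF I]
  define A B where "A = \<phi> ` {1..k}" and "B = \<psi> ` {1..l}"
  \<comment> \<open>The numbers of letters taken from each factor up to position \<open>i\<close>,
    hence the lengths of the prefix products.\<close>
  define a b where "a i = card (A \<inter> {1..i})" and "b i = card (B \<inter> {1..i})" for i
  have a: "inv_into {1..k} \<phi> i = a i" "a i \<in> {1..k}" if "i \<in> A" for i
    using rank_inv_into[OF D(1-3)] inv_into_into[of i \<phi> "{1..k}"] that by (auto simp: A_def a_def)
  have b: "inv_into {1..l} \<psi> i = b i" "b i \<in> {1..l}" if "i \<in> B" for i
    using rank_inv_into[OF D(4-6)] inv_into_into[of i \<psi> "{1..l}"] that by (auto simp: B_def b_def)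
  have AB: "i \<in> B \<longleftrightarrow> i \<notin> A" if "i \<in> {1..k+l}" for i
    using D(8) that by (auto simp: A_def B_def)
  have ab: "a j + b j = j" if "j \<le> k + l" for j
  proof -
    have "A \<inter> {1..j} \<union> B \<inter> {1..j} = {1..j}" "(A \<inter> {1..j}) \<inter> (B \<inter> {1..j}) = {}"
      using AB that by auto
    then show ?thesis
      using card_Un_disjoint[of "A \<inter> {1..j}" "B \<inter> {1..j}"] by (simp add: a_def b_def)
  qed
  obtain j where j: "i = Suc j" using i by (cases i) auto
  have step: "card (S \<inter> {1..Suc j}) = (if Suc j \<in> S then Suc (card (S \<inter> {1..j})) else card (S \<inter> {1..j}))" for S
  proof -
    have "S \<inter> {1..Suc j} = (if Suc j \<in> S then insert (Suc j) (S \<inter> {1..j}) else S \<inter> {1..j})"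
      by (auto simp: le_Suc_eq)
    then show ?thesis by simp
  qed
  have aj: "a i = (if i \<in> A then Suc (a j) else a j)" and bj: "b i = (if i \<in> B then Suc (b j) else b j)"
    unfolding j a_def b_def by (rule step)+
  have xA: "x i = prefix_inv w (a i)" if "i \<in> A" for i
    using that a[OF that] by (simp add: x_def merge_vec_def A_def)
  have xB: "x i = prefix_inv z (b i)" if "i \<in> B" "i \<in> {1..k+l}" for i
    using that b[OF that(1)] AB[OF that(2)] by (simp add: x_def merge_vec_def A_def)
  have j1: "i = 1 \<longleftrightarrow> j = 0" "i - 1 = j" by (auto simp: j)
  have bar: "bar_shuffle G k l \<phi> \<psi> w z i =
    (if i \<in> A then if j = 0 \<or> j \<in> A then w (a i)
        else finprod G w {1..a i} \<otimes> inv (finprod G z {1..i - a i})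
      else if j = 0 \<or> j \<in> B then z (b i)
        else finprod G z {1..b i} \<otimes> inv (finprod G w {1..i - b i}))"
    using a[of i] b[of i] AB[OF i]
    unfolding bar_shuffle_def j1 A_def[symmetric] B_def[symmetric] Let_def by auto
  have "a 0 = 0" "b 0 = 0" by (auto simp: a_def b_def)
  show ?thesis
  proof (cases "i \<in> A")
    case True
    have le: "a i \<le> k" using a[OF True] by simp
    consider "j = 0 \<or> j \<in> A" | "j \<noteq> 0" "j \<in> B" using AB[of j] i j by fastforce
    then show ?thesis
    proof cases
      case 1
      \<comment> \<open>The first position belongs here too: the empty prefix product supplies the
        unit.\<close>
      then have "(if i = 1 then \<one> else x (i - 1)) = prefix_inv w (a j)"
        using xA[of j] \<open>a 0 = 0\<close> by (auto simp: j prefix_inv_0)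
      then show ?thesis
        using 1 True prefix_inv_quotient[OF w, of "a j"] le aj by (simp add: bar xA)
    next
      case 2
      have jr: "j \<in> {1..k+l}" using 2 i j by auto
      have "b j \<le> l" using b[OF 2(2)] by simp
      \<comment> \<open>Position \<open>i\<close> itself belongs to the first factor, so
        \<open>a j = a i - 1\<close> while \<open>a j + b j = i - 1\<close>.\<close>
      moreover have "b j = i - a i" using ab[of j] jr aj True j by auto
      ultimately have b: "b j = i - a i" "prefix_inv z (b j) \<in> carrier G"
        using prefix_inv_closed[OF z] by simp_all
      have "x j \<otimes> inv (x i) = prefix_inv z (b j) \<otimes> finprod G w {1..a i}"
        by (simp only: xB[OF 2(2) jr] xA[OF True] inv_prefix_inv[OF w le])
      also have "\<dots> = finprod G w {1..a i} \<otimes> prefix_inv z (b j)"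
        by (rule m_comm[OF b(2) finprod_prefix_closed[OF w le]])
      finally show ?thesis
        using 2 True AB[OF jr] b(1) by (simp add: bar j1 prefix_inv_def del: One_nat_def)
    qed
  next
    case False
    then have B: "i \<in> B" using AB[OF i] by simp
    have le: "b i \<le> l" using b[OF B] by simp
    consider "j = 0 \<or> j \<in> B" | "j \<noteq> 0" "j \<in> A" using AB[of j] i j by fastforce
    then show ?thesis
    proof cases
      case 1
      then have "(if i = 1 then \<one> else x (i - 1)) = prefix_inv z (b j)"
        using xB[of j] \<open>b 0 = 0\<close> i by (auto simp: j prefix_inv_0)
      then show ?thesis
        using 1 False B prefix_inv_quotient[OF z, of "b j"] le bj i by (simp add: bar xB)
    next
      case 2
      have jr: "j \<in> {1..k+l}" using 2 i j by auto
      have "a j \<le> k" using a[OF 2(2)] by simp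
      moreover have "a j = i - b i" using ab[of j] jr bj B j by auto
      ultimately have a: "a j = i - b i" "prefix_inv w (a j) \<in> carrier G"
        using prefix_inv_closed[OF w] by simp_all
      have "x j \<otimes> inv (x i) = prefix_inv w (a j) \<otimes> finprod G z {1..b i}"
        by (simp only: xA[OF 2(2)] xB[OF B i] inv_prefix_inv[OF z le])
      also have "\<dots> = finprod G z {1..b i} \<otimes> prefix_inv w (a j)"
        by (rule m_comm[OF a(2) finprod_prefix_closed[OF z le]])
      finally show ?thesis
        using 2 False AB[OF jr] a(1) by (simp add: bar j1 prefix_inv_def del: One_nat_def)
    qed
  qed
qed

end

lemma shuffle_frag_of: "shuffle (frag_of u) (frag_of v) = shuffle_word u v"
  by (simp add: shuffle_def)

theorem theorem2p2:
  fixes G :: "('g, 'm) monoid_scheme" (structure)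
    and k l :: nat and r s :: "nat \<Rightarrow> nat" and w z :: "nat \<Rightarrow> 'g"
  assumes "comm_group G"
    and "1 \<le> k" and "1 \<le> l"
    and "r \<in> {1..k} \<rightarrow> {1..}" and "w \<in> {1..k} \<rightarrow> carrier G"
    and "s \<in> {1..l} \<rightarrow> {1..}" and "z \<in> {1..l} \<rightarrow> carrier G"
  shows "shuffle_eta G (frag_of (vec_word k r w)) (frag_of (vec_word l s z)) =
    (\<Sum>(\<phi>, \<psi>) \<in> I_pairs k l. \<Sum>t \<in> T_vecs k l r s.
       frag_cmul (c_coeff k l r s t \<phi> \<psi>)
         (frag_of (vec_word (k + l) t (bar_shuffle G k l \<phi> \<psi> w z))))"
proof -
  interpret comm_group G by fact
  define x where "x \<phi> \<psi> = merge_vec k l \<phi> \<psi> (prefix_inv w) (prefix_inv z)" for \<phi> \<psi>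
  have r: "1 \<le> r i" if "i \<in> {1..k}" for i using assms(4) that by auto
  have s: "1 \<le> s i" if "i \<in> {1..l}" for i using assms(6) that by auto
  \<comment> \<open>On each word of the expansion \<open>eta\<close> replaces the merged letters by
    their successive quotients, which are the entries of \<open>bar_shuffle\<close>.\<close>
  have eta: "eta G (frag_of (basis_word (k + l) t (x \<phi> \<psi>))) =
      frag_of (vec_word (k + l) t (bar_shuffle G k l \<phi> \<psi> w z))"
    if I: "(\<phi>, \<psi>) \<in> I_pairs k l" and t: "t \<in> T_vecs k l r s" for \<phi> \<psi> t
  proof -
    have "1 \<le> t i" if "i \<in> {1..k+l}" for i using t that by (auto simp: T_vecs_def)
    from eta_word_basis_word[of "k + l" t G "x \<phi> \<psi>", OF this] have "eta G (frag_of (basis_word (k + l) t (x \<phi> \<psi>))) = frag_of (vec_word (k + l) t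
        (\<lambda>i. (if i = 1 then \<one> else x \<phi> \<psi> (i - 1)) \<otimes> inv (x \<phi> \<psi> i)))"
      by (simp add: eta_def del: One_nat_def)
    also have "vec_word (k + l) t (\<lambda>i. (if i = 1 then \<one> else x \<phi> \<psi> (i - 1)) \<otimes> inv (x \<phi> \<psi> i)) =
        vec_word (k + l) t (bar_shuffle G k l \<phi> \<psi> w z)"
      unfolding vec_word_def x_def
      by (rule map_cong[OF refl]) (use bar_shuffle_eq_quotient[OF I _ assms(5,7)] in \<open>simp del: upt_Suc\<close>)
    finally show ?thesis .
  qed
  have "shuffle_eta G (frag_of (vec_word k r w)) (frag_of (vec_word l s z)) =
    eta G (shuffle_word (basis_word k r (prefix_inv w)) (basis_word l s (prefix_inv z)))"
    using inv_into_eta[of k r w, OF r assms(5)] inv_into_eta[of l s z, OF s assms(7)]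
    by (simp add: shuffle_eta_def shuffle_frag_of)
  also have "\<dots> = eta G (\<Sum>(\<phi>, \<psi>)\<in>I_pairs k l. \<Sum>t\<in>T_vecs k l r s.
      frag_cmul (c_coeff k l r s t \<phi> \<psi>) (frag_of (basis_word (k + l) t (x \<phi> \<psi>))))"
    unfolding x_def using assms(2) r s by (subst shuffle_word_basis_word) auto
  \<comment> \<open>Linearity of \<open>eta\<close> over the finite index sets.\<close>
  also have "\<dots> = (\<Sum>(\<phi>, \<psi>)\<in>I_pairs k l. \<Sum>t\<in>T_vecs k l r s.
      frag_cmul (c_coeff k l r s t \<phi> \<psi>) (eta G (frag_of (basis_word (k + l) t (x \<phi> \<psi>)))))"
    unfolding eta_def
    by (simp add: frag_extend_sum frag_extend_cmul finite_I_pairs finite_T_vecs comp_def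
        case_prod_unfold del: frag_extend_of)
  also have "\<dots> = (\<Sum>(\<phi>, \<psi>)\<in>I_pairs k l. \<Sum>t\<in>T_vecs k l r s.
      frag_cmul (c_coeff k l r s t \<phi> \<psi>) (frag_of (vec_word (k + l) t (bar_shuffle G k l \<phi> \<psi> w z))))"
    by (intro sum.cong refl) (auto simp: eta)
  finally show ?thesis .
qed

end
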